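(* Let $G$ be an infinite group with a finite-index normal subgroup $H$ which has an infinite abelian quotient. Let $\omega$ be a weight on $G$. Then $\ell^1(G,\omega)$ has a finite-codimension maximal left ideal that is not finitely generated. In particular, $\ell^1(G,\omega)$ satisfies the Dales--\.Zelazko conjecture, i.e. it has a maximal left ideal which is not finitely generated.
   Context: Groups are discrete. A weight on a group $G$ is a function $\omega\colon G\to[1,\infty)$ with $\omega(st)\le\omega(s)\omega(t)$ for all $s,t\in G$ and $\omega(e)=1$. The Beurling algebra is $\ell^1(G,\omega)=\{f\colon G\to\mathbb{C} : \sum_{t\in G}|f(t)|\omega(t)<\infty\}$, a unital Banach algebra under convolution with norm $\|f\|_\omega=\sum_{t\in G}|f(t)|\omega(t)$. A left ideal $I$ of a unital Banach algebra $A$ is finitely generated if there are $n\in\mathbb{N}$ and $a_1,\dots,a_n\in I$ with $I=Aa_1+\cdots+Aa_n$ (algebraically; no closure is taken). The Dales--\.Zelazko conjecture asserts that every infinite-dimensional unital Banach algebra has a maximal left ideal which is not finitely generated. *)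

theory Defs
  imports "HOL-Analysis.Infinite_Sum" "HOL-Algebra.Module" "HOL-Algebra.Coset"
    "HOL-Algebra.Algebraic_Closure_Type"
begin

definition weight_on :: "('a, 'm) monoid_scheme \<Rightarrow> ('a \<Rightarrow> real) \<Rightarrow> bool" where
  "weight_on G \<omega> \<longleftrightarrow>
     (\<forall>s\<in>carrier G. 1 \<le> \<omega> s) \<and>
     (\<forall>s\<in>carrier G. \<forall>t\<in>carrier G. \<omega> (s \<otimes>\<^bsub>G\<^esub> t) \<le> \<omega> s * \<omega> t) \<and>
     \<omega> \<one>\<^bsub>G\<^esub> = 1"

definition has_infinite_abelian_quotient :: "('a, 'm) monoid_scheme \<Rightarrow> bool" where
  "has_infinite_abelian_quotient G \<longleftrightarrow>
     (\<exists>N. N \<lhd> G \<and> comm_group (G Mod N) \<and> infinite (carrier (G Mod N)))"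

text \<open>A function on the group is represented by its extension by zero to the whole type, so
  that equality of elements of the algebra is equality on the carrier of the group. Since
  \<^term>\<open>\<omega>\<close> is positive on the carrier, summability below says exactly that
  \<open>\<Sum>t. \<bar>f t\<bar> * \<omega> t\<close> is finite. The norm is not part of the record: (left)
  ideals, finite generation and codimension refer to the algebra structure only.\<close>

definition beurling_algebra ::
    "('a, 'm) monoid_scheme \<Rightarrow> ('a \<Rightarrow> real) \<Rightarrow> (complex, 'a \<Rightarrow> complex) module" where
  "beurling_algebra G \<omega> =
     \<lparr> carrier = {f. (\<forall>t. t \<notin> carrier G \<longrightarrow> f t = 0) \<and>
                     (\<lambda>t. cmod (f t) * \<omega> t) summable_on carrier G},
       monoid.mult = (\<lambda>f g t. if t \<in> carrier G
                  then \<Sum>\<^sub>\<infinity>s\<in>carrier G. f s * g (inv\<^bsub>G\<^esub> s \<otimes>\<^bsub>G\<^esub> t) else 0),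
       one = (\<lambda>t. if t = \<one>\<^bsub>G\<^esub> then 1 else 0),
       ring.zero = (\<lambda>t. 0),
       add = (\<lambda>f g t. f t + g t),
       module.smult = (\<lambda>c f t. c * f t) \<rparr>"

text \<open>The following notions are meant for a unital, not necessarily commutative, complex
  algebra \<open>A\<close>; the scalars are all of type \<^typ>\<open>complex\<close>.\<close>

definition left_ideal :: "'b set \<Rightarrow> (complex, 'b) module \<Rightarrow> bool" where
  "left_ideal I A \<longleftrightarrow>
     submodule I (ring_of_type_algebra :: complex ring) A \<and>
     (\<forall>a\<in>carrier A. \<forall>x\<in>I. a \<otimes>\<^bsub>A\<^esub> x \<in> I)"

definition maximal_left_ideal :: "'b set \<Rightarrow> (complex, 'b) module \<Rightarrow> bool" where
  "maximal_left_ideal I A \<longleftrightarrow>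
     left_ideal I A \<and> I \<noteq> carrier A \<and>
     (\<forall>J. left_ideal J A \<and> I \<subseteq> J \<longrightarrow> J = I \<or> J = carrier A)"

definition finitely_generated_left_ideal :: "'b set \<Rightarrow> (complex, 'b) module \<Rightarrow> bool" where
  "finitely_generated_left_ideal I A \<longleftrightarrow>
     left_ideal I A \<and>
     (\<exists>(n::nat) a. a \<in> {..<n} \<rightarrow> I \<and>
        I = {(\<Oplus>\<^bsub>A\<^esub>i\<in>{..<n}. x i \<otimes>\<^bsub>A\<^esub> a i) | x. x \<in> {..<n} \<rightarrow> carrier A})"

text \<open>The quotient space \<open>A / I\<close> is spanned by the classes of finitely many elements
  \<open>b i\<close>.\<close>

definition finite_codimension :: "'b set \<Rightarrow> (complex, 'b) module \<Rightarrow> bool" where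
  "finite_codimension I A \<longleftrightarrow>
     (\<exists>(n::nat) b. b \<in> {..<n} \<rightarrow> carrier A \<and>
        (\<forall>f\<in>carrier A. \<exists>u\<in>I. \<exists>c. f = u \<oplus>\<^bsub>A\<^esub> (\<Oplus>\<^bsub>A\<^esub>i\<in>{..<n}. c i \<odot>\<^bsub>A\<^esub> b i)))"

end

theory Submission
  imports Defs "HOL-Algebra.Generated_Groups"
begin

text \<open>
Write \<open>A\<close> for the Beurling algebra.  The ideal is found among the submodules attached to a positive
character \<open>\<chi>\<close> of \<open>H\<close> with \<open>\<chi> \<le> \<omega>\<close>: let \<open>L\<close> be the set of all \<open>f\<close> with
\<open>\<Sum>\<^sub>\<infinity>h\<in>H. f (t h) \<chi> h = 0\<close> for every \<open>t\<close>.  This is a left ideal (\<open>A / L\<close> is the representation induced from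
\<open>\<chi>\<close>), and its codimension is at most the index of \<open>H\<close>.

It suffices that \<open>L\<close> is not finitely generated.  If a left ideal \<open>I\<close> of finite codimension is neither
finitely generated nor maximal, choose \<open>a\<close> such that \<open>I + A a\<close> lies strictly between \<open>I\<close> and \<open>A\<close>.  Since
\<open>(I + A a) / I\<close> is isomorphic to \<open>A / (I : a)\<close>, where \<open>(I : a)\<close> consists of the \<open>y\<close> with \<open>y a \<in> I\<close>, both
\<open>I + A a\<close> and \<open>(I : a)\<close> have smaller codimension than \<open>I\<close>.  They cannot both be finitely generated, because
then \<open>I\<close> would be; so one of them continues the descent, which must end in a maximal left ideal
(\<open>exists_maximal_without_finite_generating_set\<close>).

That \<open>L\<close> is not finitely generated is a duality argument.  By the open mapping theorem, generators \<open>a\<close>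
of \<open>L\<close> would bound the norm of every functional \<open>\<phi>\<close> on \<open>L\<close> by the norms of its translates \<open>a \<cdot> \<phi>\<close>.  It is
therefore enough to have functionals, uniformly bounded above, and bounded below on \<open>L\<close>, for which finitely
many prescribed \<open>a \<cdot> \<phi>\<close> are arbitrarily small.  The proof of \<open>L_not_fg\<close> does this by hand: if
\<open>\<phi>\<^sub>k\<close> is such a functional with \<open>a \<cdot> \<phi>\<^sub>k\<close> of size \<open>4\<^sup>-\<^sup>k\<close>, then the \<open>f\<close> with \<open>f \<cdot> \<phi>\<^sub>k = O(4\<^sup>-\<^sup>k)\<close> form a left
ideal containing all \<open>a\<close>, whereas a superposition with coefficients \<open>2\<^sup>-\<^sup>k\<close> of elements of \<open>L\<close> on which the
\<open>\<phi>\<^sub>k\<close> are large lies in \<open>L\<close> but not in that ideal.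

An element of \<open>L\<close> is, up to a small tail, a combination of left translates of elements \<open>\<delta>\<^sub>h - \<chi> h\<close>,
so the functionals can be functions \<open>0 \<le> \<phi> \<le> \<omega>\<close> on \<open>H\<close> with \<open>\<phi> (x h) \<approx> \<chi> h \<phi> x\<close> for finitely many \<open>h\<close>; for the lower bound
on \<open>L\<close> they should vanish at the unit and be comparable to \<open>\<omega>\<close> at some point.  There are two cases
(\<open>exists_peaked_character\<close>).  If \<open>H\<close> is not finitely generated, take \<open>\<chi> = 1\<close> and for \<open>\<phi>\<close> a multiple of the
indicator function of a coset of the subgroup generated by the given \<open>h\<close>.  If \<open>H\<close> is finitely generated,
the infinite abelian quotient provides a homomorphism \<open>\<theta>\<close> onto the integers.  Let \<open>W n\<close> be the infimum of
\<open>\<omega>\<close> over the fibre of \<open>n\<close>, and \<open>\<rho>\<close> the limit of \<open>W n\<close> to the power \<open>1 / n\<close>; take \<open>\<chi> = \<rho>\<close> to the power \<open>\<theta>\<close>.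
This character is on the boundary of the annulus of all characters that factor through \<open>\<theta>\<close> and are bounded by \<open>\<omega>\<close>, so that
\<open>W n / \<rho>\<^sup>n\<close> grows subexponentially, and slowly increasing functions can catch up with it.
\<close>

section \<open>Left ideals in complex algebras\<close>

text \<open>Generation is expressed through the left ideals containing the generators, so that it can be transported
between left ideals without manipulating finite sums.\<close>
definition has_finite_generating_set :: "'b set \<Rightarrow> (complex, 'b) module \<Rightarrow> bool" where
  "has_finite_generating_set I A \<longleftrightarrow> (\<exists>S. finite S \<and> S \<subseteq> I \<and> (\<forall>J. left_ideal J A \<and> S \<subseteq> J \<longrightarrow> I \<subseteq> J))"

locale complex_algebra =
  module "ring_of_type_algebra :: complex ring" A + ring A for A :: "(complex, 'b) module" (structure) +
  assumes smult_mult_assoc: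
    "\<lbrakk>x \<in> carrier A; y \<in> carrier A\<rbrakk> \<Longrightarrow> (c \<odot>\<^bsub>A\<^esub> x) \<otimes>\<^bsub>A\<^esub> y = c \<odot>\<^bsub>A\<^esub> (x \<otimes>\<^bsub>A\<^esub> y)"
begin

lemma scalar_simps [simp]:
  "carrier (ring_of_type_algebra :: complex ring) = UNIV"
  "add (ring_of_type_algebra :: complex ring) = (+)"
  "monoid.mult (ring_of_type_algebra :: complex ring) = (*)"
  "\<one>\<^bsub>ring_of_type_algebra\<^esub> = (1::complex)"
  "\<zero>\<^bsub>ring_of_type_algebra\<^esub> = (0::complex)"
  by (simp_all add: ring_of_type_algebra_def)

lemma smult_in [simp, intro]: "x \<in> carrier A \<Longrightarrow> c \<odot>\<^bsub>A\<^esub> x \<in> carrier A"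
  by (rule smult_closed) simp_all

lemma smult_1 [simp]: "x \<in> carrier A \<Longrightarrow> 1 \<odot>\<^bsub>A\<^esub> x = x"
  using smult_one by simp

lemma smult_smult: "x \<in> carrier A \<Longrightarrow> c \<odot>\<^bsub>A\<^esub> (d \<odot>\<^bsub>A\<^esub> x) = (c * d) \<odot>\<^bsub>A\<^esub> x"
  using smult_assoc1[of c d x] by simp

lemma smult_add: "x \<in> carrier A \<Longrightarrow> (c + d) \<odot>\<^bsub>A\<^esub> x = c \<odot>\<^bsub>A\<^esub> x \<oplus> d \<odot>\<^bsub>A\<^esub> x"
  using smult_l_distr[of c d x] by simp

lemma smult_0 [simp]: "x \<in> carrier A \<Longrightarrow> 0 \<odot>\<^bsub>A\<^esub> x = \<zero>"
  using smult_l_null[of x] by simp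

lemma smult_distr: "\<lbrakk>x \<in> carrier A; y \<in> carrier A\<rbrakk> \<Longrightarrow> c \<odot>\<^bsub>A\<^esub> (x \<oplus> y) = c \<odot>\<^bsub>A\<^esub> x \<oplus> c \<odot>\<^bsub>A\<^esub> y"
  using smult_r_distr[of c x y] by simp

lemma smult_eq_mult: "x \<in> carrier A \<Longrightarrow> c \<odot>\<^bsub>A\<^esub> x = (c \<odot>\<^bsub>A\<^esub> \<one>) \<otimes> x"
  using smult_mult_assoc[of \<one> x c] by simp

text \<open>Scalars act as multiplication by multiples of the unit, which makes closure under them and under
negation automatic.\<close>
lemma left_ideal_iff:
  "left_ideal I A \<longleftrightarrow> I \<subseteq> carrier A \<and> \<zero> \<in> I \<and> (\<forall>x\<in>I. \<forall>y\<in>I. x \<oplus> y \<in> I) \<and>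
     (\<forall>a\<in>carrier A. \<forall>x\<in>I. a \<otimes> x \<in> I)"
proof
  assume I: "left_ideal I A"
  then interpret S: submodule I "ring_of_type_algebra :: complex ring" A
    by (simp add: left_ideal_def)
  show "I \<subseteq> carrier A \<and> \<zero> \<in> I \<and> (\<forall>x\<in>I. \<forall>y\<in>I. x \<oplus> y \<in> I) \<and>
     (\<forall>a\<in>carrier A. \<forall>x\<in>I. a \<otimes> x \<in> I)"
    using I S.subset S.one_closed S.m_closed by (auto simp: left_ideal_def)
next
  assume I: "I \<subseteq> carrier A \<and> \<zero> \<in> I \<and> (\<forall>x\<in>I. \<forall>y\<in>I. x \<oplus> y \<in> I) \<and>
     (\<forall>a\<in>carrier A. \<forall>x\<in>I. a \<otimes> x \<in> I)"
  have "submodule I (ring_of_type_algebra :: complex ring) A"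
  proof (rule submoduleI)
    fix a assume a: "a \<in> I"
    with I have "\<ominus> a = (\<ominus> \<one>) \<otimes> a" by (auto simp: l_minus)
    with I a show "\<ominus> a \<in> I" by auto
  next
    fix a :: complex and x assume "x \<in> I"
    with I show "a \<odot>\<^bsub>A\<^esub> x \<in> I" by (subst smult_eq_mult) auto
  qed (use I in auto)
  with I show "left_ideal I A" by (simp add: left_ideal_def)
qed

lemma left_idealI:
  assumes "I \<subseteq> carrier A" "\<zero> \<in> I" "\<And>x y. x \<in> I \<Longrightarrow> y \<in> I \<Longrightarrow> x \<oplus> y \<in> I"
    "\<And>a x. a \<in> carrier A \<Longrightarrow> x \<in> I \<Longrightarrow> a \<otimes> x \<in> I"
  shows "left_ideal I A"
  using assms by (simp add: left_ideal_iff)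

context
  fixes I assumes I: "left_ideal I A"
begin

lemma left_ideal_carrier: "x \<in> I \<Longrightarrow> x \<in> carrier A" using I by (auto simp: left_ideal_iff)
lemma left_ideal_zero: "\<zero> \<in> I" using I by (auto simp: left_ideal_iff)
lemma left_ideal_add: "x \<in> I \<Longrightarrow> y \<in> I \<Longrightarrow> x \<oplus> y \<in> I" using I by (auto simp: left_ideal_iff)
lemma left_ideal_mult: "a \<in> carrier A \<Longrightarrow> x \<in> I \<Longrightarrow> a \<otimes> x \<in> I" using I by (auto simp: left_ideal_iff)
lemma left_ideal_smult: "x \<in> I \<Longrightarrow> c \<odot>\<^bsub>A\<^esub> x \<in> I"
  using left_ideal_mult[of "c \<odot>\<^bsub>A\<^esub> \<one>" x] left_ideal_carrier by (simp add: smult_eq_mult[of x])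
lemma left_ideal_uminus: "x \<in> I \<Longrightarrow> \<ominus> x \<in> I"
  using left_ideal_mult[of "\<ominus> \<one>" x] left_ideal_carrier by (simp add: l_minus)
lemma left_ideal_add_cancel: "x \<in> carrier A \<Longrightarrow> y \<in> I \<Longrightarrow> x \<oplus> y \<in> I \<Longrightarrow> x \<in> I"
  using left_ideal_add[OF _ left_ideal_uminus, of "x \<oplus> y" y] left_ideal_carrier by (simp add: a_assoc r_neg)
lemma left_ideal_smult_cancel: "x \<in> carrier A \<Longrightarrow> c \<noteq> 0 \<Longrightarrow> c \<odot>\<^bsub>A\<^esub> x \<in> I \<Longrightarrow> x \<in> I"
  using left_ideal_smult[of "c \<odot>\<^bsub>A\<^esub> x" "inverse c"] by (simp add: smult_smult)
lemma left_ideal_finsum: "finite K \<Longrightarrow> x \<in> K \<rightarrow> I \<Longrightarrow> finsum A x K \<in> I"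
  by (induction K rule: finite_induct)
     (auto simp: finsum_insert left_ideal_zero left_ideal_add left_ideal_carrier Pi_iff)

lemma left_ideal_adjoin:
  assumes a: "a \<in> carrier A"
  shows "left_ideal {k \<oplus> y \<otimes> a | k y. k \<in> I \<and> y \<in> carrier A} A" (is "left_ideal ?J A")
proof (rule left_idealI)
  show "?J \<subseteq> carrier A" using a left_ideal_carrier by auto
  have "\<zero> = \<zero> \<oplus> \<zero> \<otimes> a" using a by simp
  then show "\<zero> \<in> ?J" using left_ideal_zero by blast
next
  fix u v assume "u \<in> ?J" "v \<in> ?J"
  then obtain k y l z where *: "u = k \<oplus> y \<otimes> a" "v = l \<oplus> z \<otimes> a"
    "k \<in> I" "l \<in> I" "y \<in> carrier A" "z \<in> carrier A" by blast
  then have "u \<oplus> v = (k \<oplus> l) \<oplus> (y \<oplus> z) \<otimes> a"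
    using a left_ideal_carrier by (simp add: l_distr a_ac)
  then show "u \<oplus> v \<in> ?J" using * left_ideal_add by blast
next
  fix b u assume "b \<in> carrier A" "u \<in> ?J"
  then obtain k y where *: "u = k \<oplus> y \<otimes> a" "k \<in> I" "y \<in> carrier A" by blast
  then have "b \<otimes> u = b \<otimes> k \<oplus> (b \<otimes> y) \<otimes> a"
    using a left_ideal_carrier \<open>b \<in> _\<close> by (simp add: r_distr m_assoc)
  then show "b \<otimes> u \<in> ?J" using * left_ideal_mult \<open>b \<in> _\<close> by blast
qed

lemma left_ideal_adjoin_base:
  assumes "x \<in> I" "a \<in> carrier A"
  shows "x \<in> {k \<oplus> y \<otimes> a | k y. k \<in> I \<and> y \<in> carrier A}"
  using assms left_ideal_carrier by (intro CollectI exI[of _ x] exI[of _ \<zero>]) simp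

lemma left_ideal_adjoin_new:
  assumes "a \<in> carrier A"
  shows "a \<in> {k \<oplus> y \<otimes> a | k y. k \<in> I \<and> y \<in> carrier A}"
  using assms left_ideal_zero by (intro CollectI exI[of _ \<zero>] exI[of _ \<one>]) simp

lemma left_ideal_quotient:
  assumes a: "a \<in> carrier A"
  shows "left_ideal {y \<in> carrier A. y \<otimes> a \<in> I} A"
  using a by (intro left_idealI) (auto simp: l_distr m_assoc left_ideal_add left_ideal_mult left_ideal_zero)

end

lemma left_ideal_Int: "left_ideal I A \<Longrightarrow> left_ideal J A \<Longrightarrow> left_ideal (I \<inter> J) A"
  by (auto simp: left_ideal_iff)

lemma finitely_generated_imp_finite_generating_set:
  assumes "finitely_generated_left_ideal I A" shows "has_finite_generating_set I A"
proof -
  from assms obtain n :: nat and a where a: "a \<in> {..<n} \<rightarrow> I"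
    and I: "I = {(\<Oplus>i\<in>{..<n}. x i \<otimes> a i) | x. x \<in> {..<n} \<rightarrow> carrier A}"
    by (auto simp: finitely_generated_left_ideal_def)
  have "I \<subseteq> J" if J: "left_ideal J A" "a ` {..<n} \<subseteq> J" for J
  proof
    fix u assume "u \<in> I"
    then obtain x where x: "u = (\<Oplus>i\<in>{..<n}. x i \<otimes> a i)" "x \<in> {..<n} \<rightarrow> carrier A"
      using I by blast
    show "u \<in> J" unfolding x(1)
      by (rule left_ideal_finsum[OF J(1)]) (use x(2) J left_ideal_mult[OF J(1)] in \<open>auto simp: Pi_iff\<close>)
  qed
  with a show ?thesis unfolding has_finite_generating_set_def by (intro exI[of _ "a ` {..<n}"]) auto
qed

text \<open>Linear independence of the classes of the \<open>x i\<close> in \<open>A / I\<close>; repetitions in the family count as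
dependences.\<close>
definition indep_mod :: "'b set \<Rightarrow> (nat \<Rightarrow> 'b) \<Rightarrow> nat set \<Rightarrow> bool" where
  "indep_mod I x K \<longleftrightarrow> finite K \<and> x \<in> K \<rightarrow> carrier A \<and>
     (\<forall>c. (\<Oplus>i\<in>K. c i \<odot>\<^bsub>A\<^esub> x i) \<in> I \<longrightarrow> (\<forall>i\<in>K. c i = 0))"

text \<open>Codimension at most \<open>n\<close>, as a bound on the size of families that are independent modulo \<open>I\<close>.\<close>
definition codim_le :: "'b set \<Rightarrow> nat \<Rightarrow> bool" where
  "codim_le I n \<longleftrightarrow> (\<forall>x K. indep_mod I x K \<longrightarrow> card K \<le> n)"

lemma indep_modD:
  assumes "indep_mod I x K"
  shows "finite K" "i \<in> K \<Longrightarrow> x i \<in> carrier A"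
    "(\<Oplus>i\<in>K. c i \<odot>\<^bsub>A\<^esub> x i) \<in> I \<Longrightarrow> i \<in> K \<Longrightarrow> c i = 0"
  using assms by (auto simp: indep_mod_def)

lemma codim_leD: "codim_le I n \<Longrightarrow> indep_mod I x K \<Longrightarrow> card K \<le> n"
  by (simp add: codim_le_def)

lemma finsum_smult_insert:
  assumes "finite K" "k \<notin> K" "x \<in> K \<rightarrow> carrier A" "a \<in> carrier A"
  shows "(\<Oplus>i\<in>insert k K. c i \<odot>\<^bsub>A\<^esub> (x(k := a)) i) = c k \<odot>\<^bsub>A\<^esub> a \<oplus> (\<Oplus>i\<in>K. c i \<odot>\<^bsub>A\<^esub> x i)"
proof -
  have "(\<Oplus>i\<in>K. c i \<odot>\<^bsub>A\<^esub> (x(k := a)) i) = (\<Oplus>i\<in>K. c i \<odot>\<^bsub>A\<^esub> x i)"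
    using assms by (intro finsum_cong') auto
  with assms show ?thesis
    by (subst finsum_insert) (auto simp: Pi_iff)
qed

text \<open>An element of \<open>J\<close> outside \<open>I\<close> extends a family that is independent modulo \<open>J\<close> to a longer one that is
independent modulo \<open>I\<close>.\<close>
lemma codim_le_larger:
  assumes I: "left_ideal I A" and J: "left_ideal J A" and "I \<subset> J" and n: "codim_le I n"
  shows "codim_le J (n - 1)"
  unfolding codim_le_def
proof (intro allI impI)
  fix x K assume x: "indep_mod J x K"
  note xD = indep_modD[OF x]
  obtain k where k: "k \<notin> K" using ex_new_if_finite[OF infinite_UNIV_nat xD(1)] by blast
  obtain a where a: "a \<in> J" "a \<notin> I" using \<open>I \<subset> J\<close> by blast
  have aA: "a \<in> carrier A" using left_ideal_carrier[OF J a(1)] .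
  have "indep_mod I (x(k := a)) (insert k K)"
    unfolding indep_mod_def
  proof (intro conjI allI impI)
    fix c assume c: "(\<Oplus>i\<in>insert k K. c i \<odot>\<^bsub>A\<^esub> (x(k := a)) i) \<in> I"
    define y where "y = (\<Oplus>i\<in>K. c i \<odot>\<^bsub>A\<^esub> x i)"
    have y: "y \<in> carrier A" unfolding y_def using xD by (intro finsum_closed) auto
    have ay: "c k \<odot>\<^bsub>A\<^esub> a \<oplus> y \<in> I"
      using c finsum_smult_insert[of K k x a c] xD k aA by (simp add: y_def Pi_iff)
    then have "y \<oplus> c k \<odot>\<^bsub>A\<^esub> a \<in> J" using aA y \<open>I \<subset> J\<close> by (auto simp: a_comm)
    then have "y \<in> J" using left_ideal_add_cancel[OF J y left_ideal_smult[OF J a(1)]] by simp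
    then have c0: "c i = 0" if "i \<in> K" for i using xD(3)[of c, folded y_def] that by blast
    have "y = (\<Oplus>i\<in>K. \<zero>)" unfolding y_def using c0 xD by (intro finsum_cong') auto
    then have "y = \<zero>" by simp
    with ay aA have "c k \<odot>\<^bsub>A\<^esub> a \<in> I" by simp
    then have "c k = 0" using left_ideal_smult_cancel[OF I aA] a(2) by blast
    with c0 show "\<forall>i\<in>insert k K. c i = 0" by simp
  qed (use xD aA in auto)
  then have "card (insert k K) \<le> n" by (rule codim_leD[OF n])
  then show "card K \<le> n - 1" using k xD(1) by simp
qed

text \<open>Right multiplication by \<open>a\<close> embeds \<open>A / (I : a)\<close> into \<open>A / I\<close> with image \<open>(I + A a) / I\<close>.  The unit lies
outside \<open>I + A a\<close>, so it can be added to the image of a family that is independent modulo \<open>(I : a)\<close>.\<close>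
lemma codim_le_quotient:
  assumes I: "left_ideal I A" and a: "a \<in> carrier A" and n: "codim_le I n"
    and J: "\<one> \<notin> {k \<oplus> y \<otimes> a | k y. k \<in> I \<and> y \<in> carrier A}"
  shows "codim_le {y \<in> carrier A. y \<otimes> a \<in> I} (n - 1)"
  unfolding codim_le_def
proof (intro allI impI)
  fix x K assume x: "indep_mod {y \<in> carrier A. y \<otimes> a \<in> I} x K"
  note xD = indep_modD[OF x]
  obtain k where k: "k \<notin> K" using ex_new_if_finite[OF infinite_UNIV_nat xD(1)] by blast
  have "indep_mod I ((\<lambda>i. x i \<otimes> a)(k := \<one>)) (insert k K)"
    unfolding indep_mod_def
  proof (intro conjI allI impI)
    fix c assume c: "(\<Oplus>i\<in>insert k K. c i \<odot>\<^bsub>A\<^esub> ((\<lambda>i. x i \<otimes> a)(k := \<one>)) i) \<in> I"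
    define y where "y = (\<Oplus>i\<in>K. c i \<odot>\<^bsub>A\<^esub> x i)"
    have y: "y \<in> carrier A" unfolding y_def using xD by (intro finsum_closed) auto
    have "y \<otimes> a = (\<Oplus>i\<in>K. c i \<odot>\<^bsub>A\<^esub> (x i \<otimes> a))"
      unfolding y_def using xD a
      by (subst finsum_ldistr) (auto simp: smult_mult_assoc intro!: finsum_cong')
    then have cy: "c k \<odot>\<^bsub>A\<^esub> \<one> \<oplus> y \<otimes> a \<in> I"
      using c finsum_smult_insert[of K k "\<lambda>i. x i \<otimes> a" \<one> c] xD k a by (simp add: Pi_iff)
    have ck: "c k = 0"
    proof (rule ccontr)
      assume ck: "c k \<noteq> 0"
      define d where "d = inverse (c k)"
      have "d \<odot>\<^bsub>A\<^esub> (c k \<odot>\<^bsub>A\<^esub> \<one> \<oplus> y \<otimes> a) = \<one> \<oplus> (d \<odot>\<^bsub>A\<^esub> y) \<otimes> a"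
        using ck y a by (simp add: smult_distr smult_smult d_def smult_mult_assoc)
      then have i: "\<one> \<oplus> (d \<odot>\<^bsub>A\<^esub> y) \<otimes> a \<in> I" using left_ideal_smult[OF I cy, of d] by simp
      have "\<one> = (\<one> \<oplus> (d \<odot>\<^bsub>A\<^esub> y) \<otimes> a) \<oplus> (\<ominus> (d \<odot>\<^bsub>A\<^esub> y)) \<otimes> a"
        using y a by (simp add: l_minus a_assoc r_neg)
      moreover have "\<ominus> (d \<odot>\<^bsub>A\<^esub> y) \<in> carrier A" using y by simp
      ultimately show False using i J by blast
    qed
    with cy y a have "y \<in> {y \<in> carrier A. y \<otimes> a \<in> I}" by simp
    then have "\<forall>i\<in>K. c i = 0" using xD(3)[of c, folded y_def] by blast
    with ck show "\<forall>i\<in>insert k K. c i = 0" by simp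
  qed (use xD a in auto)
  then have "card (insert k K) \<le> n" by (rule codim_leD[OF n])
  then show "card K \<le> n - 1" using k xD(1) by simp
qed

lemma codim_le_pos:
  assumes I: "left_ideal I A" and n: "codim_le I n" and "I \<noteq> carrier A"
  shows "n > 0"
proof -
  obtain a where a: "a \<in> carrier A" "a \<notin> I" using assms left_ideal_carrier[OF I] by blast
  have "indep_mod I (\<lambda>_. a) {0}"
    unfolding indep_mod_def using a left_ideal_smult_cancel[OF I a(1)] by auto
  from codim_leD[OF n this] show ?thesis by simp
qed

text \<open>With \<open>J = I + A a\<close>, write every generator of \<open>J\<close> as \<open>l + b a\<close> with \<open>l \<in> I\<close>.  Then \<open>I\<close> is generated by these
elements \<open>l\<close> together with the products \<open>c a\<close>, where \<open>c\<close> runs through generators of \<open>(I : a)\<close>.\<close>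
lemma finite_generating_set_extension:
  assumes I: "left_ideal I A" and a: "a \<in> carrier A"
    and J: "has_finite_generating_set {k \<oplus> y \<otimes> a | k y. k \<in> I \<and> y \<in> carrier A} A" (is "has_finite_generating_set ?J A")
    and Q: "has_finite_generating_set {y \<in> carrier A. y \<otimes> a \<in> I} A" (is "has_finite_generating_set ?Q A")
  shows "has_finite_generating_set I A"
proof -
  obtain S where S: "finite S \<and> S \<subseteq> ?J \<and> (\<forall>K. left_ideal K A \<and> S \<subseteq> K \<longrightarrow> ?J \<subseteq> K)"
    using J unfolding has_finite_generating_set_def by (rule exE)
  have S_min: "?J \<subseteq> K" if "left_ideal K A" "S \<subseteq> K" for K
    by (rule S[THEN conjunct2, THEN conjunct2, rule_format, OF conjI[OF that]])
  obtain T where T: "finite T \<and> T \<subseteq> ?Q \<and> (\<forall>K. left_ideal K A \<and> T \<subseteq> K \<longrightarrow> ?Q \<subseteq> K)"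
    using Q unfolding has_finite_generating_set_def by (rule exE)
  have T_min: "?Q \<subseteq> K" if "left_ideal K A" "T \<subseteq> K" for K
    by (rule T[THEN conjunct2, THEN conjunct2, rule_format, OF conjI[OF that]])
  have "\<forall>s\<in>S. \<exists>l b. l \<in> I \<and> b \<in> carrier A \<and> s = l \<oplus> b \<otimes> a" using S[THEN conjunct2, THEN conjunct1] by blast
  then obtain l b where lb: "\<And>s. s \<in> S \<Longrightarrow> l s \<in> I"
      "\<And>s. s \<in> S \<Longrightarrow> b s \<in> carrier A" "\<And>s. s \<in> S \<Longrightarrow> s = l s \<oplus> b s \<otimes> a"
    by metis
  define U where "U = l ` S \<union> (\<lambda>c. c \<otimes> a) ` T"
  have fin: "finite S" "finite T"
    by (rule S[THEN conjunct1], rule T[THEN conjunct1])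
  have TQ: "T \<subseteq> ?Q" by (rule T[THEN conjunct2, THEN conjunct1])
  have U: "finite U" "U \<subseteq> I" using fin TQ lb(1) by (auto simp: U_def)
  have "I \<subseteq> K0" if K0: "left_ideal K0 A" "U \<subseteq> K0" for K0
  proof
    fix x assume x: "x \<in> I"
    \<comment> \<open>Cutting down to \<open>I\<close> makes \<open>k \<in> I\<close> in the decomposition \<open>x = k + y a\<close> below, so that \<open>y \<in> (I : a)\<close>.\<close>
    define K where "K = K0 \<inter> I"
    have K: "left_ideal K A" "U \<subseteq> K" "K \<subseteq> I" using K0 I U by (auto simp: K_def left_ideal_Int)
    have "S \<subseteq> {k \<oplus> y \<otimes> a | k y. k \<in> K \<and> y \<in> carrier A}"
    proof
      fix s assume s: "s \<in> S"
      then have "l s \<in> K" using K(2) by (auto simp: U_def)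
      then show "s \<in> {k \<oplus> y \<otimes> a | k y. k \<in> K \<and> y \<in> carrier A}"
        using lb(2)[OF s] lb(3)[OF s] by (intro CollectI exI conjI)
    qed
    then have sub: "?J \<subseteq> {k \<oplus> y \<otimes> a | k y. k \<in> K \<and> y \<in> carrier A}"
      by (rule S_min[OF left_ideal_adjoin[OF K(1) a]])
    have "x \<in> ?J" by (rule left_ideal_adjoin_base[OF I x a])
    then have "x \<in> {k \<oplus> y \<otimes> a | k y. k \<in> K \<and> y \<in> carrier A}" by (rule subsetD[OF sub])
    then obtain k y where ky: "x = k \<oplus> y \<otimes> a" "k \<in> K" "y \<in> carrier A" by blast
    have "y \<otimes> a \<oplus> k \<in> I" using x ky a left_ideal_carrier[OF K(1)] by (simp add: a_comm)
    then have "y \<otimes> a \<in> I" using left_ideal_add_cancel[OF I, of "y \<otimes> a" k] ky a K(3) by auto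
    then have "y \<in> ?Q" using ky by simp
    moreover have "?Q \<subseteq> {y \<in> carrier A. y \<otimes> a \<in> K}"
      using TQ K(2) by (intro T_min left_ideal_quotient[OF K(1) a]) (auto simp: U_def)
    ultimately have "y \<otimes> a \<in> K" by blast
    then have "x \<in> K" unfolding ky(1) by (rule left_ideal_add[OF K(1) ky(2)])
    then show "x \<in> K0" by (simp add: K_def)
  qed
  with U show ?thesis unfolding has_finite_generating_set_def by blast
qed

text \<open>Descent on the codimension: for a non-maximal \<open>I\<close>, one of \<open>I + A a\<close> and \<open>(I : a)\<close> inherits the failure of
finite generation and has smaller codimension.\<close>
lemma exists_maximal_without_finite_generating_set:
  assumes "left_ideal I A" "codim_le I n" "\<not> has_finite_generating_set I A"
  shows "\<exists>M m. maximal_left_ideal M A \<and> codim_le M m \<and> \<not> has_finite_generating_set M A"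
  using assms
proof (induction n arbitrary: I rule: less_induct)
  case (less n)
  note I = less.prems(1)
  have ne: "I \<noteq> carrier A"
  proof
    assume IA: "I = carrier A"
    have "I \<subseteq> J" if J: "left_ideal J A" "{\<one>} \<subseteq> J" for J
      using left_ideal_mult[OF J(1), of _ \<one>] J(2) IA by auto
    then have "has_finite_generating_set I A" unfolding has_finite_generating_set_def by (intro exI[of _ "{\<one>}"]) (auto simp: IA)
    with less.prems show False by blast
  qed
  have npos: "n > 0" by (rule codim_le_pos[OF I less.prems(2) ne])
  show ?case
  proof (cases "maximal_left_ideal I A")
    case True
    with less.prems show ?thesis by blast
  next
    case False
    then obtain J where J: "left_ideal J A" "I \<subseteq> J" "J \<noteq> I" "J \<noteq> carrier A"
      using I ne unfolding maximal_left_ideal_def by metis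
    then obtain a where a: "a \<in> J" "a \<notin> I" by blast
    have aA: "a \<in> carrier A" using left_ideal_carrier[OF J(1) a(1)] .
    let ?J = "{k \<oplus> y \<otimes> a | k y. k \<in> I \<and> y \<in> carrier A}"
    let ?Q = "{y \<in> carrier A. y \<otimes> a \<in> I}"
    have "?J \<subseteq> J"
    proof
      fix x assume "x \<in> ?J"
      then obtain k y where x: "x = k \<oplus> y \<otimes> a" and k: "k \<in> I" and y: "y \<in> carrier A" by blast
      show "x \<in> J" unfolding x
        by (rule left_ideal_add[OF J(1) subsetD[OF J(2) k] left_ideal_mult[OF J(1) y a(1)]])
    qed
    moreover have "\<one> \<notin> J"
    proof
      assume "\<one> \<in> J"
      then have "x \<in> J" if "x \<in> carrier A" for x
        using left_ideal_mult[OF J(1) that, of \<one>] that by simp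
      then show False using left_ideal_carrier[OF J(1)] J(4) by blast
    qed
    ultimately have one: "\<one> \<notin> ?J" by (rule contra_subsetD)
    have "I \<subset> ?J"
    proof
      show "I \<subseteq> ?J" by (rule subsetI, rule left_ideal_adjoin_base[OF I _ aA])
      show "I \<noteq> ?J"
      proof
        assume "I = ?J"
        moreover have "a \<in> ?J" by (rule left_ideal_adjoin_new[OF I aA])
        ultimately show False using a(2) by (simp only: simp_thms)
      qed
    qed
    then have J_le: "codim_le ?J (n - 1)"
      by (rule codim_le_larger[OF I left_ideal_adjoin[OF I aA] _ less.prems(2)])
    have Q_le: "codim_le ?Q (n - 1)"
      by (rule codim_le_quotient[OF I aA less.prems(2) one])
    have n1: "n - 1 < n" using npos by simp
    show ?thesis
    proof (cases "has_finite_generating_set ?J A")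
      case False
      show ?thesis by (rule less.IH[OF n1 left_ideal_adjoin[OF I aA] J_le False])
    next
      case True
      from less.prems(3) have "\<not> has_finite_generating_set ?Q A"
        by (rule contrapos_nn) (rule finite_generating_set_extension[OF I aA True])
      then show ?thesis by (rule less.IH[OF n1 left_ideal_quotient[OF I aA] Q_le])
    qed
  qed
qed

text \<open>An independent family of maximal size spans the quotient.\<close>
lemma codim_le_imp_finite_codimension:
  assumes I: "left_ideal I A" and n: "codim_le I n"
  shows "finite_codimension I A"
proof -
  define P where "P m \<longleftrightarrow> (\<exists>x K. indep_mod I x K \<and> card K = m)" for m
  have "indep_mod I (\<lambda>_. \<zero>) {}" by (simp add: indep_mod_def)
  then have P0: "P 0" unfolding P_def by (intro exI[of _ "\<lambda>_. \<zero>"] exI[of _ "{}"]) simp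
  have Pn: "\<And>m. P m \<Longrightarrow> m \<le> n" using n by (auto simp: P_def codim_le_def)
  define m where "m = (GREATEST m. P m)"
  have "P m" unfolding m_def by (rule GreatestI_nat[of P, OF P0 Pn])
  then obtain x K where x: "indep_mod I x K" "card K = m" by (auto simp: P_def)
  note xD = indep_modD[OF x(1)]
  obtain k where k: "k \<notin> K" using ex_new_if_finite[OF infinite_UNIV_nat xD(1)] by blast
  obtain h where h: "bij_betw h {..<m} K"
    using ex_bij_betw_nat_finite[OF xD(1)] x(2) by (auto simp: atLeast0LessThan)
  have span: "\<exists>u\<in>I. \<exists>c. f = u \<oplus> (\<Oplus>i\<in>{..<m}. c i \<odot>\<^bsub>A\<^esub> x (h i))" if f: "f \<in> carrier A" for f
  proof -
    have "\<not> indep_mod I (x(k := f)) (insert k K)"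
    proof
      assume "indep_mod I (x(k := f)) (insert k K)"
      then have "P (Suc m)" unfolding P_def using x k xD(1) by (metis card_insert_disjoint)
      then have "Suc m \<le> m" unfolding m_def by (rule Greatest_le_nat[of P _ n, OF _ Pn])
      then show False by simp
    qed
    moreover have "x(k := f) \<in> insert k K \<rightarrow> carrier A" "finite (insert k K)"
      using xD f by auto
    ultimately obtain c where c: "(\<Oplus>i\<in>insert k K. c i \<odot>\<^bsub>A\<^esub> (x(k := f)) i) \<in> I"
      "\<not> (\<forall>i\<in>insert k K. c i = 0)"
      unfolding indep_mod_def by blast
    define y where "y = (\<Oplus>i\<in>K. c i \<odot>\<^bsub>A\<^esub> x i)"
    have y: "y \<in> carrier A" unfolding y_def using xD by (intro finsum_closed) auto
    have cy: "c k \<odot>\<^bsub>A\<^esub> f \<oplus> y \<in> I"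
      using c finsum_smult_insert[of K k x f c] xD k f by (simp add: y_def Pi_iff)
    have ck: "c k \<noteq> 0"
    proof
      assume ck: "c k = 0"
      with cy f y have "y \<in> I" by simp
      then have "\<forall>i\<in>K. c i = 0" using xD(3)[of c, folded y_def] by blast
      with ck c(2) show False by simp
    qed
    define d where "d = inverse (c k)"
    have u: "d \<odot>\<^bsub>A\<^esub> (c k \<odot>\<^bsub>A\<^esub> f \<oplus> y) \<in> I" using left_ideal_smult[OF I cy] .
    have eq: "d \<odot>\<^bsub>A\<^esub> (c k \<odot>\<^bsub>A\<^esub> f \<oplus> y) = f \<oplus> d \<odot>\<^bsub>A\<^esub> y"
      using ck y f by (simp add: smult_distr smult_smult d_def)
    have "(\<Oplus>i\<in>{..<m}. (- d * c (h i)) \<odot>\<^bsub>A\<^esub> x (h i)) = (\<Oplus>i\<in>h ` {..<m}. (- d * c i) \<odot>\<^bsub>A\<^esub> x i)"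
      using h xD by (subst finsum_reindex) (auto simp: bij_betw_def)
    also have "h ` {..<m} = K" using h by (simp add: bij_betw_def)
    also have "(\<Oplus>i\<in>K. (- d * c i) \<odot>\<^bsub>A\<^esub> x i) = (\<Oplus>i\<in>K. (- d) \<odot>\<^bsub>A\<^esub> (c i \<odot>\<^bsub>A\<^esub> x i))"
      using xD by (intro finsum_cong') (auto simp: smult_smult)
    also have "\<dots> = (- d) \<odot>\<^bsub>A\<^esub> y"
      unfolding y_def using finsum_smult_ldistr[OF xD(1), of "- d" "\<lambda>i. c i \<odot>\<^bsub>A\<^esub> x i"] xD
      by (simp add: Pi_iff)
    finally have *: "(\<Oplus>i\<in>{..<m}. (- d * c (h i)) \<odot>\<^bsub>A\<^esub> x (h i)) = (- d) \<odot>\<^bsub>A\<^esub> y" .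
    have "f = (f \<oplus> d \<odot>\<^bsub>A\<^esub> y) \<oplus> (- d) \<odot>\<^bsub>A\<^esub> y"
      using f y smult_add[OF y, of d "- d"] by (simp add: a_assoc)
    then show ?thesis using u eq * by metis
  qed
  have "x \<circ> h \<in> {..<m} \<rightarrow> carrier A" using h xD by (auto simp: bij_betw_def)
  with span show ?thesis unfolding finite_codimension_def
    by (intro exI[of _ m] exI[of _ "x \<circ> h"]) auto
qed

text \<open>If \<open>l (x j)\<close> is nonzero, subtracting multiples of \<open>x j\<close> moves the other members of the family into the kernel
of \<open>l\<close>; what remains is independent modulo \<open>I\<close>.\<close>
lemma codim_le_kernel:
  assumes n: "codim_le I n"
    and add: "\<And>x y. x \<in> carrier A \<Longrightarrow> y \<in> carrier A \<Longrightarrow> l (x \<oplus> y) = l x + l y"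
    and smult: "\<And>c x. x \<in> carrier A \<Longrightarrow> l (c \<odot>\<^bsub>A\<^esub> x) = c * (l x :: complex)"
  shows "codim_le {x \<in> I. l x = 0} (Suc n)"
  unfolding codim_le_def
proof (intro allI impI)
  fix x K assume x: "indep_mod {x \<in> I. l x = 0} x K"
  note xD = indep_modD[OF x]
  have l_sum: "l (\<Oplus>i\<in>F. c i \<odot>\<^bsub>A\<^esub> y i) = (\<Sum>i\<in>F. c i * l (y i))"
    if "finite F" "y \<in> F \<rightarrow> carrier A" for F :: "nat set" and c y
    using that
  proof (induction F rule: finite_induct)
    case empty
    show ?case using smult[of \<zero> 0] by simp
  next
    case (insert i F)
    then show ?case by (subst finsum_insert) (auto simp: add smult Pi_iff finsum_closed)
  qed
  show "card K \<le> Suc n"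
  proof (cases "\<forall>i\<in>K. l (x i) = 0")
    case True
    have "indep_mod I x K" unfolding indep_mod_def
    proof (intro conjI allI impI)
      fix c assume "(\<Oplus>i\<in>K. c i \<odot>\<^bsub>A\<^esub> x i) \<in> I"
      then have "(\<Oplus>i\<in>K. c i \<odot>\<^bsub>A\<^esub> x i) \<in> {x \<in> I. l x = 0}"
        using l_sum[of K x c] xD True by simp
      then show "\<forall>i\<in>K. c i = 0" using xD(3)[of c] by blast
    qed (use xD in auto)
    from codim_leD[OF n this] show ?thesis by simp
  next
    case False
    then obtain j where j: "j \<in> K" "l (x j) \<noteq> 0" by blast
    define r where "r i = - (l (x i) / l (x j))" for i
    define y where "y i = x i \<oplus> r i \<odot>\<^bsub>A\<^esub> x j" for i
    have ly: "l (y i) = 0" if "i \<in> K" for i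
      using that j xD by (simp add: y_def add smult r_def)
    have yA: "y i \<in> carrier A" if "i \<in> K" for i using that j xD by (simp add: y_def)
    have "indep_mod I y (K - {j})" unfolding indep_mod_def
    proof (intro conjI allI impI)
      fix c assume c: "(\<Oplus>i\<in>K - {j}. c i \<odot>\<^bsub>A\<^esub> y i) \<in> I"
      define e where "e = (\<Sum>i\<in>K - {j}. c i * r i)"
      have sum_r: "(\<Oplus>i\<in>F. (c i * r i) \<odot>\<^bsub>A\<^esub> x j) = (\<Sum>i\<in>F. c i * r i) \<odot>\<^bsub>A\<^esub> x j"
        if "finite F" for F
        using that j xD
        by (induction F rule: finite_induct) (auto simp: finsum_insert smult_add Pi_iff)
      have "(\<Oplus>i\<in>K - {j}. c i \<odot>\<^bsub>A\<^esub> y i)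
          = (\<Oplus>i\<in>K - {j}. c i \<odot>\<^bsub>A\<^esub> x i \<oplus> (c i * r i) \<odot>\<^bsub>A\<^esub> x j)"
        using xD j by (intro finsum_cong') (auto simp: y_def smult_distr smult_smult)
      also have "\<dots> = (\<Oplus>i\<in>K - {j}. c i \<odot>\<^bsub>A\<^esub> x i) \<oplus> (\<Oplus>i\<in>K - {j}. (c i * r i) \<odot>\<^bsub>A\<^esub> x j)"
        using xD j by (intro finsum_addf) auto
      also have "\<dots> = e \<odot>\<^bsub>A\<^esub> x j \<oplus> (\<Oplus>i\<in>K - {j}. c i \<odot>\<^bsub>A\<^esub> x i)"
        using xD j by (subst sum_r) (auto simp: e_def a_comm)
      also have "\<dots> = (\<Oplus>i\<in>insert j (K - {j}). (c(j := e)) i \<odot>\<^bsub>A\<^esub> (x(j := x j)) i)"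
      proof -
        have "(\<Oplus>i\<in>K - {j}. (c(j := e)) i \<odot>\<^bsub>A\<^esub> x i) = (\<Oplus>i\<in>K - {j}. c i \<odot>\<^bsub>A\<^esub> x i)"
          using xD by (intro finsum_cong') auto
        moreover have "x \<in> K - {j} \<rightarrow> carrier A" using xD by auto
        ultimately show ?thesis
          using finsum_smult_insert[of "K - {j}" j x "x j" "c(j := e)"] xD j by simp
      qed
      finally have eq: "(\<Oplus>i\<in>K - {j}. c i \<odot>\<^bsub>A\<^esub> y i) = (\<Oplus>i\<in>K. (c(j := e)) i \<odot>\<^bsub>A\<^esub> x i)"
        using j by (simp add: insert_absorb)
      have "l (\<Oplus>i\<in>K - {j}. c i \<odot>\<^bsub>A\<^esub> y i) = 0"
        using l_sum[of "K - {j}" y c] xD ly yA by (simp add: Pi_iff)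
      with c have "(\<Oplus>i\<in>K. (c(j := e)) i \<odot>\<^bsub>A\<^esub> x i) \<in> {x \<in> I. l x = 0}" by (simp only: eq) blast
      then have "\<forall>i\<in>K. (c(j := e)) i = 0" using xD(3)[of "c(j := e)"] by blast
      then show "\<forall>i\<in>K - {j}. c i = 0" by (metis DiffE fun_upd_other singletonI)
    qed (use xD yA in auto)
    then have "card (K - {j}) \<le> n" by (rule codim_leD[OF n])
    then show ?thesis using xD(1) j by simp
  qed
qed

lemma codim_le_kernels:
  assumes "finite T"
    and add: "\<And>t x y. t \<in> T \<Longrightarrow> x \<in> carrier A \<Longrightarrow> y \<in> carrier A \<Longrightarrow> l t (x \<oplus> y) = l t x + l t y"
    and smult: "\<And>t c x. t \<in> T \<Longrightarrow> x \<in> carrier A \<Longrightarrow> l t (c \<odot>\<^bsub>A\<^esub> x) = c * (l t x :: complex)"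
  shows "codim_le {x \<in> carrier A. \<forall>t\<in>T. l t x = 0} (card T)"
  using assms
proof (induction T rule: finite_induct)
  case empty
  have K: "K = {}" if x: "indep_mod (carrier A) x K" for x K
  proof -
    have *: "(\<Oplus>i\<in>K. (\<lambda>_. 1) i \<odot>\<^bsub>A\<^esub> x i) \<in> carrier A"
      using indep_modD(2)[OF x] by (intro finsum_closed) auto
    have "(1::complex) = 0" if "i \<in> K" for i
      by (rule indep_modD(3)[OF x, where c = "\<lambda>_. 1", OF * that])
    then show ?thesis using one_neq_zero by (intro equals0I) (rule notE)
  qed
  have "codim_le (carrier A) 0"
    unfolding codim_le_def
  proof (intro allI impI)
    fix x K assume "indep_mod (carrier A) x K"
    then have "K = {}" by (rule K)
    then show "card K \<le> 0" by (simp only: card.empty order_refl)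
  qed
  then show ?case by (simp only: card.empty ball_empty simp_thms Collect_mem_eq)
next
  case (insert t T)
  have eq: "{x \<in> carrier A. \<forall>t\<in>insert t T. l t x = 0}
      = {x \<in> {x \<in> carrier A. \<forall>t\<in>T. l t x = 0}. l t x = 0}" by auto
  have T: "codim_le {x \<in> carrier A. \<forall>t\<in>T. l t x = 0} (card T)"
    by (rule insert.IH; rule insert.prems; assumption?; rule insertI2)
  have "codim_le {x \<in> {x \<in> carrier A. \<forall>t\<in>T. l t x = 0}. l t x = 0} (Suc (card T))"
    by (rule codim_le_kernel[OF T]; rule insert.prems; assumption?; rule insertI1)
  then show ?case unfolding eq using insert.hyps by simp
qed

end

section \<open>Homomorphisms onto the integers\<close>

context comm_group
begin

lemma generate_insert_decompose:
  assumes F: "F \<subseteq> carrier G" and q: "q \<in> carrier G" and x: "x \<in> generate G (insert q F)"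
  shows "\<exists>y\<in>generate G F. \<exists>i::int. x = y \<otimes> q [^] i"
  using x
proof (induction x rule: generate.induct)
  case one
  show ?case
    by (intro bexI[of _ \<one>] exI[of _ 0]) (auto simp: generate.one)
next
  case (incl h)
  show ?case
  proof (cases "h = q")
    case True
    with q show ?thesis by (intro bexI[of _ \<one>] exI[of _ 1]) (auto simp: generate.one int_pow_1)
  next
    case False
    with incl F show ?thesis
      by (intro bexI[of _ h] exI[of _ 0]) (auto intro: generate.incl)
  qed
next
  case (inv h)
  show ?case
  proof (cases "h = q")
    case True
    with q show ?thesis
      by (intro bexI[of _ \<one>] exI[of _ "-1"]) (auto simp: generate.one int_pow_neg int_pow_1)
  next
    case False
    with inv F show ?thesis
      by (intro bexI[of _ "inv h"] exI[of _ 0]) (auto intro: generate.inv)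
  qed
next
  case (eng h1 h2)
  then obtain y1 y2 and i j :: int where *: "y1 \<in> generate G F" "y2 \<in> generate G F"
    "h1 = y1 \<otimes> q [^] i" "h2 = y2 \<otimes> q [^] j" by blast
  have "y1 \<in> carrier G" "y2 \<in> carrier G" using * F generate_in_carrier by auto
  then have "h1 \<otimes> h2 = (y1 \<otimes> y2) \<otimes> q [^] (i + j)"
    using * q by (simp add: int_pow_mult m_ac)
  then show ?case by (intro bexI[OF _ generate.eng[OF *(1,2)]] exI)
qed

text \<open>Induction on the number of generators.  If no positive power of the new generator \<open>q\<close> lies in the subgroup
\<open>K\<close> generated by the others, the exponent of \<open>q\<close> is the desired homomorphism.  If \<open>q\<^sup>k \<in> K\<close>, then \<open>K\<close> has
finite index, so it is infinite, and a homomorphism \<open>\<theta>\<close> on \<open>K\<close> yields the homomorphism \<open>x \<mapsto> \<theta> (x\<^sup>k)\<close> on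
the larger group.\<close>
lemma fg_infinite_imp_int_hom:
  assumes "finite F" "F \<subseteq> carrier G" "infinite (generate G F)"
  shows "\<exists>\<theta>::'a \<Rightarrow> int. (\<forall>x\<in>generate G F. \<forall>y\<in>generate G F. \<theta> (x \<otimes> y) = \<theta> x + \<theta> y) \<and>
    (\<exists>x\<in>generate G F. \<theta> x \<noteq> 0)"
  using assms
proof (induction F rule: finite_induct)
  case empty
  then show ?case by (simp add: generate_empty)
next
  case (insert q F)
  define K where "K = generate G F"
  define S where "S = generate G (insert q F)"
  have q: "q \<in> carrier G" and F: "F \<subseteq> carrier G" using insert by auto
  interpret K: subgroup K G unfolding K_def by (rule generate_is_subgroup[OF F])
  interpret S: subgroup S G unfolding S_def by (rule generate_is_subgroup[OF insert.prems(1)])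
  have qS: "q \<in> S" unfolding S_def by (rule generate.incl) simp
  have KS: "K \<subseteq> S" unfolding K_def S_def by (rule mono_generate) auto
  have dec: "\<exists>y\<in>K. \<exists>i::int. x = y \<otimes> q [^] i" if "x \<in> S" for x
    using generate_insert_decompose[OF F q] that by (simp add: K_def S_def)
  have Kpow: "y [^] (i::int) \<in> K" if "y \<in> K" for y i
    using subgroup_int_pow_closed[OF K.subgroup_axioms that] .
  have Knpow: "y [^] (i::nat) \<in> K" if "y \<in> K" for y i
    using Kpow[OF that, of "int i"] by (simp add: int_pow_int)
  show ?case
  proof (cases "\<exists>k>0. q [^] (k::nat) \<in> K")
    case True
    then obtain k :: nat where k: "k > 0" "q [^] k \<in> K" by blast
    have qk: "(q [^] k) [^] i = q [^] (int k * i)" for i :: int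
      using q int_pow_pow[of q "int k" i] by (simp add: int_pow_int)
    have "infinite K"
    proof
      assume fin: "finite K"
      have "S \<subseteq> (\<lambda>(y, i). y \<otimes> q [^] (i::int)) ` (K \<times> {0..<int k})"
      proof
        fix x assume "x \<in> S"
        then obtain y i where y: "y \<in> K" "x = y \<otimes> q [^] (i::int)" using dec by blast
        have "q [^] i = (q [^] k) [^] (i div int k) \<otimes> q [^] (i mod int k)"
          using q by (simp add: qk flip: int_pow_mult)
        then have "x = (y \<otimes> (q [^] k) [^] (i div int k)) \<otimes> q [^] (i mod int k)"
          using y q K.subset by (simp add: m_assoc)
        moreover have "y \<otimes> (q [^] k) [^] (i div int k) \<in> K" using y k Kpow by blast
        ultimately show "x \<in> (\<lambda>(y, i). y \<otimes> q [^] (i::int)) ` (K \<times> {0..<int k})"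
          using k(1) by force
      qed
      then have "finite S" by (rule finite_subset) (use fin in auto)
      with insert.prems show False by (simp add: S_def)
    qed
    then obtain \<theta> :: "'a \<Rightarrow> int" where \<theta>: "\<And>x y. x \<in> K \<Longrightarrow> y \<in> K \<Longrightarrow> \<theta> (x \<otimes> y) = \<theta> x + \<theta> y"
      "\<exists>x\<in>K. \<theta> x \<noteq> 0"
      using insert.IH F by (auto simp: K_def)
    have powK: "x [^] k \<in> K" if x: "x \<in> S" for x
    proof -
      obtain y i where y: "y \<in> K" "x = y \<otimes> q [^] (i::int)" using dec x by blast
      have "(q [^] i) [^] k = (q [^] k) [^] i"
        using q int_pow_pow[of q i "int k"] by (simp add: qk int_pow_int mult.commute)
      then have "x [^] k = y [^] k \<otimes> (q [^] k) [^] i"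
        using y q by (simp add: pow_mult_distrib m_comm)
      then show ?thesis using y k Kpow Knpow by simp
    qed
    have "\<theta> ((x \<otimes> y) [^] k) = \<theta> (x [^] k) + \<theta> (y [^] k)" if "x \<in> S" "y \<in> S" for x y
      using that by (simp add: pow_mult_distrib m_comm \<theta>(1) powK)
    moreover have "\<exists>x\<in>S. \<theta> (x [^] k) \<noteq> 0"
    proof -
      obtain x where x: "x \<in> K" "\<theta> x \<noteq> 0" using \<theta>(2) by blast
      have "\<theta> \<one> = 0" using \<theta>(1)[of \<one> \<one>] by simp
      then have "\<theta> (x [^] n) = int n * \<theta> x" for n :: nat
        using x by (induction n) (auto simp: \<theta>(1) Knpow algebra_simps)
      then have "\<theta> (x [^] k) \<noteq> 0" using x k by simp
      with x KS show ?thesis by blast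
    qed
    ultimately show ?thesis
      by (intro exI[of _ "\<lambda>x. \<theta> (x [^] k)"]) (auto simp: S_def)
  next
    case False
    have q0: "i = 0" if i: "q [^] (i::int) \<in> K" for i
    proof (rule ccontr)
      assume "i \<noteq> 0"
      have "q [^] \<bar>i\<bar> \<in> K" using i q K.m_inv_closed[OF i] by (cases "i \<ge> 0") (auto simp: int_pow_neg)
      then have "q [^] nat \<bar>i\<bar> \<in> K" using int_pow_int[of G q "nat \<bar>i\<bar>"] by simp
      moreover have "nat \<bar>i\<bar> > 0" using \<open>i \<noteq> 0\<close> by simp
      ultimately show False using False by blast
    qed
    define \<theta> where "\<theta> x = (THE i::int. \<exists>y\<in>K. x = y \<otimes> q [^] i)" for x
    have \<theta>: "\<theta> (y \<otimes> q [^] i) = i" if y: "y \<in> K" for y i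
      unfolding \<theta>_def
    proof (rule the_equality)
      show "\<exists>z\<in>K. y \<otimes> q [^] i = z \<otimes> q [^] i" using y by blast
    next
      fix j :: int assume "\<exists>z\<in>K. y \<otimes> q [^] i = z \<otimes> q [^] j"
      then obtain z where z: "z \<in> K" "y \<otimes> q [^] i = z \<otimes> q [^] j" by blast
      have yz: "y \<in> carrier G" "z \<in> carrier G" using y z by auto
      have "inv z \<otimes> y \<otimes> q [^] i = q [^] j"
        using z(2) yz q by (simp add: m_assoc inv_solve_left')
      then have "q [^] j \<otimes> inv (q [^] i) = inv z \<otimes> y"
        using yz q by (metis inv_closed inv_solve_right int_pow_closed m_closed)
      then have "q [^] (j - i) = inv z \<otimes> y" using q by (simp add: int_pow_diff)
      then have "q [^] (j - i) \<in> K" using y z by simp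
      then show "j = i" using q0 by fastforce
    qed
    have "\<theta> (x \<otimes> y) = \<theta> x + \<theta> y" if "x \<in> S" "y \<in> S" for x y
    proof -
      obtain a b and i j :: int where *: "a \<in> K" "b \<in> K" "x = a \<otimes> q [^] i" "y = b \<otimes> q [^] j"
        using dec \<open>x \<in> S\<close> \<open>y \<in> S\<close> by metis
      then have "x \<otimes> y = (a \<otimes> b) \<otimes> q [^] (i + j)"
        using q K.subset by (simp add: int_pow_mult m_ac subset_iff)
      with * show ?thesis by (simp add: \<theta>)
    qed
    moreover have "\<theta> q = 1" using \<theta>[of \<one> 1] q by (simp add: int_pow_1)
    ultimately show ?thesis using qS
      by (intro exI[of _ \<theta>]) (auto simp: S_def intro!: bexI[of _ q])
  qed
qed

end

context group
begin

text \<open>Divide by the least positive value.\<close>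
lemma int_hom_normalise:
  assumes add: "\<And>x y. x \<in> carrier G \<Longrightarrow> y \<in> carrier G \<Longrightarrow> \<theta> (x \<otimes> y) = \<theta> x + (\<theta> y :: int)"
    and nz: "\<exists>x\<in>carrier G. \<theta> x \<noteq> 0"
  shows "\<exists>\<theta>'::'a \<Rightarrow> int. (\<forall>x\<in>carrier G. \<forall>y\<in>carrier G. \<theta>' (x \<otimes> y) = \<theta>' x + \<theta>' y) \<and>
    \<theta>' ` carrier G = UNIV"
proof -
  have \<theta>1: "\<theta> \<one> = 0" using add[of \<one> \<one>] by simp
  have \<theta>inv: "\<theta> (inv x) = - \<theta> x" if "x \<in> carrier G" for x
    using add[of x "inv x"] that \<theta>1 by simp
  have \<theta>npow: "\<theta> (x [^] n) = int n * \<theta> x" if "x \<in> carrier G" for x and n :: nat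
    using that by (induction n) (auto simp: add \<theta>1 algebra_simps)
  have \<theta>pow: "\<theta> (x [^] i) = i * \<theta> x" if "x \<in> carrier G" for x and i :: int
    using that by (cases i rule: int_cases2) (auto simp: \<theta>npow int_pow_neg int_pow_int \<theta>inv)
  define P where "P n \<longleftrightarrow> n > 0 \<and> (\<exists>x\<in>carrier G. \<theta> x = int n)" for n
  have "\<exists>n. P n"
  proof -
    obtain x where x: "x \<in> carrier G" "\<theta> x \<noteq> 0" using nz by blast
    show ?thesis
    proof (cases "\<theta> x > 0")
      case True
      with x show ?thesis unfolding P_def by (intro exI[of _ "nat (\<theta> x)"]) auto
    next
      case False
      with x show ?thesis unfolding P_def
        by (intro exI[of _ "nat (- \<theta> x)"] conjI bexI[of _ "inv x"]) (auto simp: \<theta>inv)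
    qed
  qed
  define d where "d = (LEAST n. P n)"
  have "P d" unfolding d_def by (rule LeastI_ex) fact
  then obtain g where g: "d > 0" "g \<in> carrier G" "\<theta> g = int d" by (auto simp: P_def)
  have dvd: "int d dvd \<theta> x" if x: "x \<in> carrier G" for x
  proof -
    have "\<theta> (x \<otimes> g [^] (- (\<theta> x div int d))) = \<theta> x mod int d"
      using x g by (simp add: add \<theta>pow minus_div_mult_eq_mod[symmetric])
    moreover have "\<not> P (nat (\<theta> x mod int d))"
      using g(1) by (intro not_less_Least[of _ P, folded d_def]) (simp add: nat_less_iff)
    moreover have "\<theta> x mod int d \<ge> 0" using g(1) by simp
    ultimately have "\<theta> x mod int d = 0" using x g unfolding P_def
      by (metis int_pow_closed m_closed nat_0_le zero_less_nat_eq order_le_less)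
    then show ?thesis by auto
  qed
  define \<theta>' where "\<theta>' x = \<theta> x div int d" for x
  have "\<theta>' (x \<otimes> y) = \<theta>' x + \<theta>' y" if "x \<in> carrier G" "y \<in> carrier G" for x y
    using that dvd by (simp add: \<theta>'_def add div_plus_div_distrib_dvd_left)
  moreover have "\<theta>' (g [^] i) = i" for i :: int using g by (simp add: \<theta>'_def \<theta>pow)
  then have "\<theta>' ` carrier G = UNIV" using g(2) by (metis int_pow_closed rangeI surj_def UNIV_eq_I image_eqI)
  ultimately show ?thesis by blast
qed

lemma fg_imp_surj_int_hom:
  assumes q: "has_infinite_abelian_quotient G" and F: "finite F" "F \<subseteq> carrier G"
    and gen: "generate G F = carrier G"
  shows "\<exists>\<theta>::'a \<Rightarrow> int. (\<forall>x\<in>carrier G. \<forall>y\<in>carrier G. \<theta> (x \<otimes> y) = \<theta> x + \<theta> y) \<and>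
    \<theta> ` carrier G = UNIV"
proof -
  obtain N where N: "N \<lhd> G" "comm_group (G Mod N)" "infinite (carrier (G Mod N))"
    using q by (auto simp: has_infinite_abelian_quotient_def)
  interpret N: normal N G by fact
  interpret Q: comm_group "G Mod N" by fact
  interpret p: group_hom G "G Mod N" "\<lambda>a. N #> a"
    by (intro group_hom.intro group_hom_axioms.intro N.r_coset_hom_Mod) (auto intro: Q.is_group group_axioms)
  have img: "(\<lambda>a. N #> a) ` carrier G = carrier (G Mod N)"
    by (auto simp: FactGroup_def RCOSETS_def)
  have F': "(\<lambda>a. N #> a) ` F \<subseteq> carrier (G Mod N)" using F img by blast
  have genQ: "generate (G Mod N) ((\<lambda>a. N #> a) ` F) = carrier (G Mod N)"
    using p.generate_img[OF F(2)] gen img by simp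
  obtain \<theta> :: "'a set \<Rightarrow> int" where
    \<theta>: "\<forall>x\<in>carrier (G Mod N). \<forall>y\<in>carrier (G Mod N). \<theta> (x \<otimes>\<^bsub>G Mod N\<^esub> y) = \<theta> x + \<theta> y"
       "\<exists>x\<in>carrier (G Mod N). \<theta> x \<noteq> 0"
    using Q.fg_infinite_imp_int_hom[OF _ F'] F(1) N(3) genQ by auto
  show ?thesis
  proof (rule int_hom_normalise[of "\<lambda>a. \<theta> (N #> a)"])
    fix x y assume "x \<in> carrier G" "y \<in> carrier G"
    then show "\<theta> (N #> (x \<otimes> y)) = \<theta> (N #> x) + \<theta> (N #> y)"
      using \<theta>(1) p.hom_mult[of x y] p.hom_closed by auto
  next
    show "\<exists>x\<in>carrier G. \<theta> (N #> x) \<noteq> 0" using \<theta>(2) unfolding img[symmetric] by auto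
  qed
qed

end

section \<open>Weights on the integers\<close>

text \<open>A weight on the group of integers, which is written additively and so does not fit the multiplicative
notation for groups.\<close>
locale int_weight =
  fixes W :: "int \<Rightarrow> real"
  assumes W_ge_1: "1 \<le> W n" and W_submult: "W (m + n) \<le> W m * W n" and W_0: "W 0 = 1"
begin

text \<open>This supremum is the limit of \<open>W n\<close> to the power \<open>1 / n\<close> as \<open>n\<close> tends to infinity, the spectral radius of
the shift.\<close>
definition \<rho> :: real where "\<rho> = Sup {r. 0 \<le> r \<and> (\<forall>n\<ge>1. r ^ n \<le> W (int n))}"

lemma rate_bdd: "bdd_above {r. 0 \<le> r \<and> (\<forall>n\<ge>1. r ^ n \<le> W (int n))}"
proof (rule bdd_aboveI[of _ "W 1"])
  fix r assume "r \<in> {r. 0 \<le> r \<and> (\<forall>n\<ge>1. r ^ n \<le> W (int n))}"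
  then have "r ^ 1 \<le> W (int 1)" by blast
  then show "r \<le> W 1" by simp
qed

lemma rho_ge_1: "1 \<le> \<rho>"
  unfolding \<rho>_def by (rule cSup_upper[OF _ rate_bdd]) (use W_ge_1 in simp)

lemma rho_power_le: "\<rho> ^ n \<le> W (int n)"
proof (cases "n = 0")
  case False
  then have n: "n > 0" by simp
  have "\<rho> \<le> root n (W (int n))"
    unfolding \<rho>_def
  proof (rule cSup_least)
    show "{r. 0 \<le> r \<and> (\<forall>n\<ge>1. r ^ n \<le> W (int n))} \<noteq> {}"
      using W_ge_1 by (auto intro!: exI[of _ 1])
    fix r assume "r \<in> {r. 0 \<le> r \<and> (\<forall>n\<ge>1. r ^ n \<le> W (int n))}"
    then have r: "0 \<le> r" "r ^ n \<le> W (int n)" using n by auto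
    then have "root n (r ^ n) \<le> root n (W (int n))" using n by simp
    then show "r \<le> root n (W (int n))" using r n by (simp add: real_root_power_cancel)
  qed
  then have "\<rho> ^ n \<le> root n (W (int n)) ^ n" using rho_ge_1 by (intro power_mono) auto
  also have "\<dots> = W (int n)" using n W_ge_1[of "int n"] by simp
  finally show ?thesis .
qed (simp add: W_0)

lemma rho_optimal:
  assumes "s > \<rho>" shows "\<exists>n\<ge>1. W (int n) < s ^ n"
proof (rule ccontr)
  assume "\<not> ?thesis"
  then have "s \<in> {r. 0 \<le> r \<and> (\<forall>n\<ge>1. r ^ n \<le> W (int n))}" using assms rho_ge_1 by force
  then have "s \<le> \<rho>" unfolding \<rho>_def by (rule cSup_upper[OF _ rate_bdd])
  with assms show False by simp
qed

text \<open>The weight relative to the extremal character.\<close>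
definition u :: "int \<Rightarrow> real" where "u n = W n * \<rho> powi (- n)"

lemma rho_pos: "\<rho> > 0" using rho_ge_1 by simp

lemma W_eq: "W n = \<rho> powi n * u n"
  using rho_pos by (simp add: u_def power_int_minus)

lemma u_0: "u 0 = 1" by (simp add: u_def W_0)

lemma u_submult: "u (m + n) \<le> u m * u n"
proof -
  have eq: "\<rho> powi (- (m + n)) = \<rho> powi (- m) * \<rho> powi (- n)"
    using rho_pos power_int_add[of \<rho> "- m" "- n"] by simp
  have "W (m + n) * \<rho> powi (- (m + n)) \<le> (W m * W n) * \<rho> powi (- (m + n))"
    using rho_pos by (intro mult_right_mono W_submult) auto
  then show ?thesis unfolding u_def eq by (simp only: mult_ac)
qed

lemma rho_powi_le: "\<rho> powi n \<le> W n"
proof (cases "n \<ge> 0")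
  case True
  with rho_power_le[of "nat n"] show ?thesis by (simp add: power_int_def)
next
  case False
  then have "\<rho> powi n \<le> 1"
    using rho_ge_1 by (simp add: power_int_def power_le_one inverse_le_1_iff)
  with W_ge_1[of n] show ?thesis by simp
qed

lemma u_ge_1: "1 \<le> u n"
  using rho_powi_le[of n] rho_pos W_eq[of n] zero_less_power_int[OF rho_pos, of n]
  by (metis mult.right_neutral mult_le_cancel_left_pos)

lemma u_power: "u (int n * m) \<le> u m ^ n"
proof (induction n)
  case (Suc n)
  have "u (int (Suc n) * m) = u (m + int n * m)" by (simp add: algebra_simps)
  also have "\<dots> \<le> u m * u (int n * m)" by (rule u_submult)
  also have "\<dots> \<le> u m * u m ^ n" using Suc u_ge_1[of m] by (intro mult_left_mono) auto
  finally show ?case by simp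
qed (simp add: u_0)

text \<open>Otherwise the partial sums of \<open>u\<close> would grow at least like \<open>(1 + e)\<^sup>n\<close>, and with them \<open>u\<close> itself.  By
submultiplicativity this contradicts the extremality of \<open>\<rho>\<close>.\<close>
lemma exists_partial_sum_dominating:
  assumes e: "e > 0"
  shows "\<exists>n. u (int n) \<le> e * (\<Sum>k<n. u (int k))"
proof (rule ccontr)
  assume "\<not> ?thesis"
  then have neg: "e * (\<Sum>k<n. u (int k)) < u (int n)" for n by (simp add: not_le)
  have S: "(1 + e) ^ n \<le> (\<Sum>k<Suc n. u (int k))" for n
  proof (induction n)
    case (Suc n)
    have "(1 + e) ^ Suc n \<le> (1 + e) * (\<Sum>k<Suc n. u (int k))"
      using Suc e by (simp add: mult_left_mono)
    also have "\<dots> \<le> (\<Sum>k<Suc (Suc n). u (int k))"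
      using neg[of "Suc n"] by (simp add: algebra_simps)
    finally show ?case .
  qed (simp add: u_0)
  have lower: "e / (1 + e) * (1 + e) ^ n \<le> u (int n)" if n: "n \<ge> 1" for n
  proof -
    obtain m where m: "n = Suc m" using n by (cases n) auto
    have "e / (1 + e) * (1 + e) ^ n = e * (1 + e) ^ m" using e m by simp
    also have "\<dots> \<le> e * (\<Sum>k<Suc m. u (int k))" using S[of m] e by simp
    also have "\<dots> \<le> u (int n)" using neg[of n] m by simp
    finally show ?thesis .
  qed
  have "\<rho> * (1 + e) > \<rho>" using rho_pos e by simp
  from rho_optimal[OF this] obtain n where n: "n \<ge> 1" "W (int n) < (\<rho> * (1 + e)) ^ n" by blast
  have "\<rho> ^ n * u (int n) < \<rho> ^ n * (1 + e) ^ n"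
    using n(2) W_eq[of "int n"] by (simp add: power_mult_distrib)
  then have un: "u (int n) < (1 + e) ^ n" using rho_pos by simp
  define r where "r = u (int n) / (1 + e) ^ n"
  have r: "0 \<le> r" "r < 1" using un e u_ge_1[of "int n"] by (auto simp: r_def divide_simps)
  have "e / (1 + e) \<le> r ^ k" if k: "k \<ge> 1" for k
  proof -
    have "e / (1 + e) * (1 + e) ^ (k * n) \<le> u (int (k * n))" using lower[of "k * n"] n(1) k by simp
    also have "\<dots> \<le> u (int n) ^ k" using u_power[of k "int n"] by simp
    finally have "e / (1 + e) \<le> u (int n) ^ k / (1 + e) ^ (k * n)"
      using e by (simp add: pos_le_divide_eq)
    also have "\<dots> = r ^ k" by (simp add: r_def power_divide power_mult[symmetric] mult.commute)
    finally show ?thesis .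
  qed
  moreover obtain k where "r ^ k < e / (1 + e)"
    using real_arch_pow_inv[of "e / (1 + e)" r] e r by auto
  moreover have "r ^ Suc k \<le> r ^ k" using r by (intro power_decreasing) auto
  moreover have "e / (1 + e) \<le> r ^ Suc k" by (rule calculation(1)) simp
  ultimately show False by linarith
qed

lemma slowly_varying_shift:
  assumes v: "\<And>n. \<bar>v (n + 1) - v n\<bar> \<le> e * u n" and e: "e \<ge> 0"
  shows "\<bar>v (n + k) - v n\<bar> \<le> e * (\<Sum>j<nat \<bar>k\<bar>. u (int j)) * u k * u n"
proof -
  have pos: "\<bar>v (n + int m) - v n\<bar> \<le> e * (\<Sum>j<m. u (int j)) * u n" for m n
  proof (induction m)
    case (Suc m)
    have "\<bar>v (n + int (Suc m)) - v n\<bar> \<le> \<bar>v (n + int m + 1) - v (n + int m)\<bar> + \<bar>v (n + int m) - v n\<bar>"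
      by (simp add: algebra_simps)
    also have "\<dots> \<le> e * u (n + int m) + e * (\<Sum>j<m. u (int j)) * u n"
      by (intro add_mono v Suc)
    also have "\<dots> \<le> e * (u n * u (int m)) + e * (\<Sum>j<m. u (int j)) * u n"
      using e by (intro add_right_mono mult_left_mono u_submult)
    finally show ?case by (simp add: algebra_simps)
  qed simp
  have S: "0 \<le> (\<Sum>j<m. u (int j))" for m
    using u_ge_1 by (intro sum_nonneg) (meson order_trans zero_le_one)
  define P where "P = e * (\<Sum>j<nat \<bar>k\<bar>. u (int j))"
  have P: "0 \<le> P" unfolding P_def using e S by simp
  show ?thesis
  proof (cases "k \<ge> 0")
    case True
    then have "\<bar>v (n + k) - v n\<bar> \<le> P * u n" using pos[of n "nat k"] by (simp add: P_def)
    also have "\<dots> \<le> P * u k * u n"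
      using P u_ge_1[of n] mult_left_mono[OF u_ge_1[of k] P] by (intro mult_right_mono) auto
    finally show ?thesis by (simp add: P_def)
  next
    case False
    then have "\<bar>v (n + k) - v n\<bar> \<le> P * u (n + k)"
      using pos[of "n + k" "nat (- k)"] by (simp add: abs_minus_commute P_def)
    also have "\<dots> \<le> P * (u n * u k)" using P by (intro mult_left_mono u_submult)
    finally show ?thesis by (simp add: mult_ac P_def)
  qed
qed

text \<open>Let \<open>v\<close> vanish on the negative integers and then increase by \<open>e * u m\<close> in step \<open>m\<close>, until it is cut off at
a constant \<open>c\<close>.  It stays below \<open>u\<close> up to the first index \<open>n0\<close> at which it would overtake \<open>u\<close>; if \<open>c\<close> is the
infimum of \<open>u\<close> beyond \<open>n0\<close>, it stays below \<open>u\<close> forever, and is comparable to \<open>u\<close> wherever \<open>u\<close> nearly attains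
this infimum.\<close>
lemma exists_slowly_varying:
  assumes e: "e > 0"
  shows "\<exists>v n. v 0 = 0 \<and> (\<forall>m. 0 \<le> v m \<and> v m \<le> u m) \<and> (\<forall>m. \<bar>v (m + 1) - v m\<bar> \<le> e * u m) \<and>
    u n \<le> 2 * v n"
proof -
  define S where "S n = (\<Sum>k<n. u (int k))" for n
  define n0 where "n0 = (LEAST n. u (int n) \<le> e * S n)"
  have u0: "0 \<le> u n" for n using u_ge_1[of n] by simp
  have n0: "u (int n0) \<le> e * S n0"
    unfolding n0_def by (rule LeastI_ex) (use exists_partial_sum_dominating[OF e] in \<open>simp add: S_def\<close>)
  have below: "e * S n < u (int n)" if "n < n0" for n
    using not_less_Least[of n "\<lambda>n. u (int n) \<le> e * S n"] that by (simp add: n0_def not_le)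
  have S_mono: "S m \<le> S n" if "m \<le> n" for m n
    unfolding S_def using that u0 by (intro sum_mono2) auto
  have S_pos: "0 \<le> S n" for n unfolding S_def using u0 by (intro sum_nonneg) auto
  define c where "c = Inf ((\<lambda>n. u (int n)) ` {n0..})"
  have bdd: "bdd_below ((\<lambda>n. u (int n)) ` {n0..})" using u0 by (intro bdd_belowI[of _ 0]) auto
  have c_le: "c \<le> u (int n)" if "n \<ge> n0" for n
    unfolding c_def by (rule cInf_lower[OF _ bdd]) (use that in auto)
  have "1 \<le> c" unfolding c_def by (rule cInf_greatest) (use u_ge_1 in auto)
  then have "c < 2 * c" by simp
  then obtain n1 where n1: "n1 \<ge> n0" "u (int n1) < 2 * c"
    unfolding c_def by (subst (asm) cInf_less_iff) (use bdd in auto)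
  define v where "v m = (if m \<ge> 0 then min c (e * S (nat m)) else 0)" for m
  have "v 0 = 0" using \<open>1 \<le> c\<close> by (simp add: v_def S_def)
  moreover have "0 \<le> v m" for m using \<open>1 \<le> c\<close> e S_pos by (simp add: v_def)
  moreover have "v m \<le> u m" for m
  proof (cases "m \<ge> 0")
    case True
    then obtain n where n: "m = int n" using nonneg_int_cases by blast
    show ?thesis using c_le[of n] below[of n] by (cases "n < n0") (auto simp: v_def n)
  next
    case False
    with u0 show ?thesis by (simp add: v_def)
  qed
  moreover have "\<bar>v (m + 1) - v m\<bar> \<le> e * u m" for m
  proof (cases "m \<ge> 0")
    case True
    then obtain n where n: "m = int n" using nonneg_int_cases by blast
    have "nat (m + 1) = Suc n" using n by simp
    moreover have "e * S (Suc n) = e * S n + e * u m" by (simp add: S_def n algebra_simps)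
    moreover have "0 \<le> e * u m" using e u0 by simp
    ultimately show ?thesis by (auto simp: v_def n min_def abs_if)
  next
    case False
    then have "v (m + 1) = 0" using \<open>1 \<le> c\<close> by (cases "m = -1") (auto simp: v_def S_def)
    with False show ?thesis using e u0 by (simp add: v_def)
  qed
  moreover have "u (int n1) \<le> 2 * v (int n1)"
  proof -
    have "c \<le> e * S n1" using c_le[of n0] n0 S_mono[OF n1(1)] e
      by (meson mult_left_mono order_less_imp_le order_refl order_trans)
    with n1(2) show ?thesis by (simp add: v_def)
  qed
  ultimately show ?thesis by blast
qed

end

section \<open>Peaked almost eigenfunctions\<close>

text \<open>The functions \<open>\<phi>\<close> are functionals of norm at most 1 on the Beurling algebra, almost invariant up to \<open>\<chi>\<close>
under translation by \<open>F\<close>.  Their value on the element \<open>\<delta>\<^sub>q - \<chi> q \<delta>\<^sub>1\<close>, which the character annihilates, is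
\<open>\<phi> q\<close> and hence comparable to the norm of that element if \<open>\<chi> \<le> \<omega>\<close>, with constants that do not depend on \<open>F\<close> and \<open>e\<close>.\<close>
definition has_peaked_almost_eigenfunctions ::
  "('a, 'm) monoid_scheme \<Rightarrow> ('a \<Rightarrow> real) \<Rightarrow> ('a \<Rightarrow> real) \<Rightarrow> bool" where
  "has_peaked_almost_eigenfunctions K \<omega> \<chi> \<longleftrightarrow>
    (\<forall>F e. finite F \<and> F \<subseteq> carrier K \<and> e > 0 \<longrightarrow>
      (\<exists>\<phi> q. q \<in> carrier K \<and> (\<forall>x\<in>carrier K. 0 \<le> \<phi> x \<and> \<phi> x \<le> \<omega> x) \<and>
        \<phi> \<one>\<^bsub>K\<^esub> = 0 \<and> \<omega> q \<le> 4 * \<phi> q \<and>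
        (\<forall>x\<in>carrier K. \<forall>h\<in>F. \<bar>\<phi> (x \<otimes>\<^bsub>K\<^esub> h) - \<chi> h * \<phi> x\<bar> \<le> e * \<omega> x)))"

context group
begin

text \<open>The coset \<open>q K\<close> of the subgroup \<open>K\<close> generated by \<open>F\<close> is invariant under right translation by \<open>F\<close>, and misses
the unit if \<open>q\<close> lies outside \<open>K\<close>.  The multiple \<open>c\<close> of its indicator function has to respect \<open>\<omega>\<close>, which allows
the infimum of \<open>\<omega>\<close> over the coset; the peak is where this infimum is nearly attained.\<close>
lemma not_fg_imp_peaked:
  assumes w: "weight_on G \<omega>"
    and nfg: "\<And>F. finite F \<Longrightarrow> F \<subseteq> carrier G \<Longrightarrow> generate G F \<noteq> carrier G"
  shows "has_peaked_almost_eigenfunctions G \<omega> (\<lambda>_. 1)"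
  unfolding has_peaked_almost_eigenfunctions_def
proof (intro allI impI, elim conjE)
  fix F and e :: real assume F: "finite F" "F \<subseteq> carrier G" and e: "e > 0"
  define K where "K = generate G F"
  interpret K: subgroup K G unfolding K_def by (rule generate_is_subgroup[OF F(2)])
  obtain q where q: "q \<in> carrier G" "q \<notin> K"
    using nfg[OF F] K.subset by (auto simp: K_def)
  define c where "c = Inf (\<omega> ` (q <# K))"
  have coset: "q <# K \<subseteq> carrier G" using q(1) K.subset by (auto simp: l_coset_def)
  have w1: "1 \<le> \<omega> x" if "x \<in> carrier G" for x using w that by (auto simp: weight_on_def)
  have bdd: "bdd_below (\<omega> ` (q <# K))" using coset w1 by (intro bdd_belowI[of _ 1]) auto
  have "q \<otimes> \<one> \<in> q <# K" unfolding l_coset_def using K.one_closed by blast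
  then have ne: "\<omega> ` (q <# K) \<noteq> {}" by blast
  have c1: "1 \<le> c" unfolding c_def by (rule cInf_greatest[OF ne]) (use coset w1 in auto)
  have cle: "c \<le> \<omega> x" if "x \<in> q <# K" for x
    unfolding c_def by (rule cInf_lower[OF _ bdd]) (use that in auto)
  have "c < 2 * c" using c1 by simp
  then obtain q' where q': "q' \<in> q <# K" "\<omega> q' < 2 * c"
    unfolding c_def by (subst (asm) cInf_less_iff[OF ne bdd]) auto
  define \<phi> where "\<phi> x = (if x \<in> q <# K then c else 0)" for x
  have inv_coset: "x \<otimes> h \<in> q <# K \<longleftrightarrow> x \<in> q <# K" if x: "x \<in> carrier G" and h: "h \<in> K" for x h
  proof
    assume "x \<otimes> h \<in> q <# K"
    then obtain k where k: "k \<in> K" "x \<otimes> h = q \<otimes> k" by (auto simp: l_coset_def)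
    have "x = x \<otimes> h \<otimes> inv h" using x h by (simp add: m_assoc)
    also have "\<dots> = q \<otimes> (k \<otimes> inv h)" using k q h by (simp add: m_assoc)
    finally show "x \<in> q <# K" using k h unfolding l_coset_def by blast
  next
    assume "x \<in> q <# K"
    then obtain k where k: "k \<in> K" "x = q \<otimes> k" by (auto simp: l_coset_def)
    then have "x \<otimes> h = q \<otimes> (k \<otimes> h)" using q h by (simp add: m_assoc)
    then show "x \<otimes> h \<in> q <# K" using k h unfolding l_coset_def by blast
  qed
  have one: "\<one> \<notin> q <# K"
  proof
    assume "\<one> \<in> q <# K"
    then obtain k where k: "k \<in> K" "\<one> = q \<otimes> k" by (auto simp: l_coset_def)
    then have "q = inv k" using q inv_equality[of q k] by auto
    then show False using k q by auto
  qed
  have FK: "F \<subseteq> K" unfolding K_def by (auto intro: generate.incl)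
  show "\<exists>\<phi> q. q \<in> carrier G \<and> (\<forall>x\<in>carrier G. 0 \<le> \<phi> x \<and> \<phi> x \<le> \<omega> x) \<and> \<phi> \<one> = 0 \<and>
      \<omega> q \<le> 4 * \<phi> q \<and> (\<forall>x\<in>carrier G. \<forall>h\<in>F. \<bar>\<phi> (x \<otimes> h) - 1 * \<phi> x\<bar> \<le> e * \<omega> x)"
  proof (intro exI[of _ \<phi>] exI[of _ q'] conjI ballI)
    show "q' \<in> carrier G" using q' coset by auto
    show "\<phi> \<one> = 0" using one by (simp add: \<phi>_def)
    show "\<omega> q' \<le> 4 * \<phi> q'" using q' c1 by (simp add: \<phi>_def)
  next
    fix x assume x: "x \<in> carrier G"
    show "0 \<le> \<phi> x" using c1 by (simp add: \<phi>_def)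
    show "\<phi> x \<le> \<omega> x" using cle w1[OF x] by (simp add: \<phi>_def)
    fix h assume "h \<in> F"
    then have "\<phi> (x \<otimes> h) = \<phi> x" using inv_coset[OF x] FK by (auto simp: \<phi>_def)
    then show "\<bar>\<phi> (x \<otimes> h) - 1 * \<phi> x\<bar> \<le> e * \<omega> x" using e w1[OF x] by simp
  qed
qed

text \<open>Pull the slowly varying function \<open>v\<close> back along \<open>\<theta>\<close> and multiply it by the extremal character.\<close>
lemma int_hom_imp_peaked:
  fixes \<theta> :: "'a \<Rightarrow> int"
  assumes w: "weight_on G \<omega>"
    and hom: "\<And>x y. x \<in> carrier G \<Longrightarrow> y \<in> carrier G \<Longrightarrow> \<theta> (x \<otimes> y) = \<theta> x + \<theta> y"
    and surj: "\<theta> ` carrier G = UNIV"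
  shows "\<exists>r::real>0. (\<forall>x\<in>carrier G. r powi \<theta> x \<le> \<omega> x) \<and>
    has_peaked_almost_eigenfunctions G \<omega> (\<lambda>x. r powi \<theta> x)"
proof -
  have w1: "1 \<le> \<omega> x" if "x \<in> carrier G" for x using w that by (auto simp: weight_on_def)
  have wm: "\<omega> (x \<otimes> y) \<le> \<omega> x * \<omega> y" if "x \<in> carrier G" "y \<in> carrier G" for x y
    using w that by (auto simp: weight_on_def)
  define fib where "fib n = {x \<in> carrier G. \<theta> x = n}" for n
  define W where "W n = Inf (\<omega> ` fib n)" for n
  have ne: "\<omega> ` fib n \<noteq> {}" for n using surj by (auto simp: fib_def image_iff set_eq_iff) metis
  have bdd: "bdd_below (\<omega> ` fib n)" for n using w1 by (intro bdd_belowI[of _ 1]) (auto simp: fib_def)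
  have W_le: "W (\<theta> x) \<le> \<omega> x" if "x \<in> carrier G" for x
    unfolding W_def by (rule cInf_lower[OF _ bdd]) (use that in \<open>auto simp: fib_def\<close>)
  have W1: "1 \<le> W n" for n
    unfolding W_def by (rule cInf_greatest[OF ne]) (use w1 in \<open>auto simp: fib_def\<close>)
  have W_approx: "\<exists>x\<in>carrier G. \<theta> x = n \<and> \<omega> x < s" if "W n < s" for n s
    using that unfolding W_def by (subst (asm) cInf_less_iff[OF ne bdd]) (auto simp: fib_def)
  interpret int_weight W
  proof
    fix m n :: int
    show "1 \<le> W n" by (rule W1)
    show "W (m + n) \<le> W m * W n"
    proof -
      have step: "W (m + n) \<le> \<omega> x * W n" if x: "x \<in> carrier G" "\<theta> x = m" for x
      proof -
        have pos: "\<omega> x > 0" using w1[OF x(1)] by simp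
        have "W (m + n) / \<omega> x \<le> W n"
          unfolding W_def[of n]
        proof (rule cInf_greatest[OF ne])
          fix s assume "s \<in> \<omega> ` fib n"
          then obtain y where y: "y \<in> carrier G" "\<theta> y = n" "s = \<omega> y" by (auto simp: fib_def)
          have "W (m + n) \<le> \<omega> (x \<otimes> y)" using W_le[of "x \<otimes> y"] x y hom by simp
          also have "\<dots> \<le> \<omega> x * \<omega> y" using x y by (intro wm)
          finally show "W (m + n) / \<omega> x \<le> s" using pos y by (simp add: pos_divide_le_eq mult.commute)
        qed
        then show ?thesis using pos by (simp add: pos_divide_le_eq mult.commute)
      qed
      have pos: "W n > 0" using W1[of n] by simp
      have "W (m + n) / W n \<le> W m"
        unfolding W_def[of m]
      proof (rule cInf_greatest[OF ne])
        fix s assume "s \<in> \<omega> ` fib m"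
        then obtain x where x: "x \<in> carrier G" "\<theta> x = m" "s = \<omega> x" by (auto simp: fib_def)
        then show "W (m + n) / W n \<le> s" using step[OF x(1,2)] pos by (simp add: pos_divide_le_eq)
      qed
      then show ?thesis using pos by (simp add: pos_divide_le_eq)
    qed
    have "\<theta> \<one> = 0" using hom[of \<one> \<one>] by simp
    then have "W 0 \<le> 1" using W_le[of \<one>] w by (simp add: weight_on_def)
    with W1[of 0] show "W 0 = 1" by simp
  qed
  have "has_peaked_almost_eigenfunctions G \<omega> (\<lambda>x. \<rho> powi \<theta> x)"
    unfolding has_peaked_almost_eigenfunctions_def
  proof (intro allI impI, elim conjE)
    fix F and e :: real assume F: "finite F" "F \<subseteq> carrier G" and e: "e > 0"
    define B where "B h = (\<Sum>j<nat \<bar>\<theta> h\<bar>. u (int j)) * u (\<theta> h) * \<rho> powi \<theta> h" for h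
    have u0: "0 \<le> u n" for n using u_ge_1[of n] by simp
    have r0: "0 < \<rho> powi n" for n using rho_pos by simp
    have B0: "0 \<le> B h" for h unfolding B_def using u0 r0[of "\<theta> h"] by (simp add: sum_nonneg)
    \<comment> \<open>\<open>B h\<close> is the factor by which a shift by \<open>\<theta> h\<close> and multiplication by the character enlarge the step
        tolerance \<open>d\<close>.\<close>
    define d where "d = e / (1 + sum B F)"
    have d: "d > 0" unfolding d_def using e B0 by (simp add: add_pos_nonneg sum_nonneg)
    have dB: "d * B h \<le> e" if "h \<in> F" for h
    proof -
      have "B h \<le> 1 + sum B F" using member_le_sum[OF that, of B] B0 F(1) by simp
      then have "e * B h \<le> e * (1 + sum B F)" using e by simp
      moreover have "1 + sum B F > 0" using B0 by (simp add: add_pos_nonneg sum_nonneg)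
      ultimately show ?thesis by (simp add: d_def pos_divide_le_eq)
    qed
    obtain v n where v: "v 0 = 0" "\<And>m. 0 \<le> v m" "\<And>m. v m \<le> u m"
        "\<And>m. \<bar>v (m + 1) - v m\<bar> \<le> d * u m" "u n \<le> 2 * v n"
      using exists_slowly_varying[OF d] by blast
    have "W n < 2 * W n" using W1[of n] by simp
    then obtain q where q: "q \<in> carrier G" "\<theta> q = n" "\<omega> q < 2 * W n" using W_approx by blast
    define \<phi> where "\<phi> x = \<rho> powi \<theta> x * v (\<theta> x)" for x
    show "\<exists>\<phi> q. q \<in> carrier G \<and> (\<forall>x\<in>carrier G. 0 \<le> \<phi> x \<and> \<phi> x \<le> \<omega> x) \<and> \<phi> \<one> = 0 \<and>
      \<omega> q \<le> 4 * \<phi> q \<and> (\<forall>x\<in>carrier G. \<forall>h\<in>F. \<bar>\<phi> (x \<otimes> h) - \<rho> powi \<theta> h * \<phi> x\<bar> \<le> e * \<omega> x)"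
    proof (intro exI[of _ \<phi>] exI[of _ q] conjI ballI)
      show "q \<in> carrier G" by (rule q)
      have "\<theta> \<one> = 0" using hom[of \<one> \<one>] by simp
      then show "\<phi> \<one> = 0" by (simp add: \<phi>_def v)
      have "\<omega> q \<le> 2 * W n" using q by simp
      also have "\<dots> = \<rho> powi n * (2 * u n)" using W_eq[of n] by simp
      also have "\<dots> \<le> \<rho> powi n * (4 * v n)" using v(5) r0[of n] by (intro mult_left_mono) auto
      finally show "\<omega> q \<le> 4 * \<phi> q" by (simp add: \<phi>_def q)
    next
      fix x assume x: "x \<in> carrier G"
      show "0 \<le> \<phi> x" using v(2) r0[of "\<theta> x"] by (simp add: \<phi>_def)
      have "\<phi> x \<le> \<rho> powi \<theta> x * u (\<theta> x)"
        unfolding \<phi>_def using v(3) r0[of "\<theta> x"] by (intro mult_left_mono) auto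
      also have "\<dots> = W (\<theta> x)" using W_eq[of "\<theta> x"] by simp
      also have "\<dots> \<le> \<omega> x" by (rule W_le[OF x])
      finally show "\<phi> x \<le> \<omega> x" .
      fix h assume h: "h \<in> F"
      then have hG: "h \<in> carrier G" using F by auto
      have rho_add: "\<rho> powi (\<theta> x + \<theta> h) = \<rho> powi \<theta> x * \<rho> powi \<theta> h"
        using rho_pos by (simp add: power_int_add)
      have "\<phi> (x \<otimes> h) - \<rho> powi \<theta> h * \<phi> x
          = \<rho> powi \<theta> x * \<rho> powi \<theta> h * (v (\<theta> x + \<theta> h) - v (\<theta> x))"
        unfolding \<phi>_def hom[OF x hG] rho_add by (simp only: algebra_simps)
      then have "\<bar>\<phi> (x \<otimes> h) - \<rho> powi \<theta> h * \<phi> x\<bar>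
          = \<rho> powi \<theta> x * \<rho> powi \<theta> h * \<bar>v (\<theta> x + \<theta> h) - v (\<theta> x)\<bar>"
        using r0[of "\<theta> x"] r0[of "\<theta> h"] by (simp add: abs_mult)
      also have "\<dots> \<le> \<rho> powi \<theta> x * \<rho> powi \<theta> h *
          (d * (\<Sum>j<nat \<bar>\<theta> h\<bar>. u (int j)) * u (\<theta> h) * u (\<theta> x))"
        using r0[of "\<theta> x"] r0[of "\<theta> h"] d v(4)
        by (intro mult_left_mono slowly_varying_shift) auto
      also have "\<dots> = d * B h * W (\<theta> x)"
        unfolding B_def W_eq[of "\<theta> x"] by (simp only: mult_ac)
      also have "\<dots> \<le> e * W (\<theta> x)"
        using W1[of "\<theta> x"] by (intro mult_right_mono dB h) auto
      also have "\<dots> \<le> e * \<omega> x" using e W_le[OF x] by simp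
      finally show "\<bar>\<phi> (x \<otimes> h) - \<rho> powi \<theta> h * \<phi> x\<bar> \<le> e * \<omega> x" .
    qed
  qed
  moreover have "\<rho> powi \<theta> x \<le> \<omega> x" if "x \<in> carrier G" for x
    using rho_powi_le[of "\<theta> x"] W_le[OF that] by simp
  ultimately show ?thesis using rho_pos by blast
qed

lemma exists_peaked_character:
  assumes w: "weight_on G \<omega>" and q: "has_infinite_abelian_quotient G"
  shows "\<exists>\<chi> :: 'a \<Rightarrow> real. (\<forall>x\<in>carrier G. 0 < \<chi> x \<and> \<chi> x \<le> \<omega> x) \<and>
    (\<forall>x\<in>carrier G. \<forall>y\<in>carrier G. \<chi> (x \<otimes> y) = \<chi> x * \<chi> y) \<and>
    has_peaked_almost_eigenfunctions G \<omega> \<chi>"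
proof (cases "\<exists>F. finite F \<and> F \<subseteq> carrier G \<and> generate G F = carrier G")
  case True
  then obtain F where F: "finite F" "F \<subseteq> carrier G" "generate G F = carrier G" by blast
  obtain \<theta> :: "'a \<Rightarrow> int" where hom: "\<forall>x\<in>carrier G. \<forall>y\<in>carrier G. \<theta> (x \<otimes> y) = \<theta> x + \<theta> y"
    and surj: "\<theta> ` carrier G = UNIV"
    using fg_imp_surj_int_hom[OF q F] by blast
  obtain r :: real where r: "r > 0" "\<forall>x\<in>carrier G. r powi \<theta> x \<le> \<omega> x"
      "has_peaked_almost_eigenfunctions G \<omega> (\<lambda>x. r powi \<theta> x)"
    using int_hom_imp_peaked[OF w _ surj] hom by blast
  then show ?thesis
    using hom by (intro exI[of _ "\<lambda>x. r powi \<theta> x"]) (simp add: power_int_add)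
next
  case False
  then have "has_peaked_almost_eigenfunctions G \<omega> (\<lambda>_. 1)"
    by (intro not_fg_imp_peaked[OF w]) blast
  then show ?thesis using w by (intro exI[of _ "\<lambda>_. 1"]) (simp add: weight_on_def)
qed

end

section \<open>The Beurling algebra and its dual module\<close>

lemma dominated_infsum:
  fixes f :: "'a \<Rightarrow> complex"
  assumes g: "g summable_on S" and le: "\<And>x. x \<in> S \<Longrightarrow> cmod (f x) \<le> g x"
  shows "f abs_summable_on S" "f summable_on S" "cmod (infsum f S) \<le> infsum g S"
proof -
  show abs: "f abs_summable_on S" by (rule summable_on_comparison_test[OF g]) (use le in auto)
  then show s: "f summable_on S" by (rule abs_summable_summable)
  show "cmod (infsum f S) \<le> infsum g S"
    by (rule norm_infsum_le[OF has_sum_infsum[OF s] has_sum_infsum[OF g] le])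
qed

locale weighted_group = group G for G (structure) +
  fixes \<omega> :: "'a \<Rightarrow> real"
  assumes weight: "weight_on G \<omega>"
begin

abbreviation B where "B \<equiv> beurling_algebra G \<omega>"

lemma w_ge_1: "x \<in> carrier G \<Longrightarrow> 1 \<le> \<omega> x"
  and w_mult: "x \<in> carrier G \<Longrightarrow> y \<in> carrier G \<Longrightarrow> \<omega> (x \<otimes> y) \<le> \<omega> x * \<omega> y"
  and w_one: "\<omega> \<one> = 1"
  using weight by (auto simp: weight_on_def)

lemma w_pos: "x \<in> carrier G \<Longrightarrow> 0 < \<omega> x" using w_ge_1[of x] by simp

lemma B_mem: "f \<in> carrier B \<longleftrightarrow> (\<forall>t. t \<notin> carrier G \<longrightarrow> f t = 0) \<and>
    (\<lambda>t. cmod (f t) * \<omega> t) summable_on carrier G"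
  by (simp add: beurling_algebra_def)

lemma B_mult: "(f \<otimes>\<^bsub>B\<^esub> g) t =
    (if t \<in> carrier G then \<Sum>\<^sub>\<infinity>s\<in>carrier G. f s * g (inv s \<otimes> t) else 0)"
  by (simp add: beurling_algebra_def)

lemma B_simps: "\<one>\<^bsub>B\<^esub> = (\<lambda>t. if t = \<one> then 1 else 0)" "\<zero>\<^bsub>B\<^esub> = (\<lambda>t. 0)"
  "f \<oplus>\<^bsub>B\<^esub> g = (\<lambda>t. f t + g t)" "c \<odot>\<^bsub>B\<^esub> f = (\<lambda>t. c * f t)"
  by (simp_all add: beurling_algebra_def)

definition wnorm :: "('a \<Rightarrow> complex) \<Rightarrow> real" where
  "wnorm f = (\<Sum>\<^sub>\<infinity>t\<in>carrier G. cmod (f t) * \<omega> t)"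

lemma wnorm_nonneg: "0 \<le> wnorm f"
  unfolding wnorm_def by (intro infsum_nonneg mult_nonneg_nonneg) (auto dest: w_pos)

lemma B_summable: "f \<in> carrier B \<Longrightarrow> (\<lambda>t. cmod (f t) * \<omega> t) summable_on carrier G"
  by (simp add: B_mem)

lemma cmod_le_wnorm:
  assumes "f \<in> carrier B" "t \<in> carrier G" shows "cmod (f t) \<le> wnorm f"
proof -
  have "cmod (f t) * 1 \<le> cmod (f t) * \<omega> t" using assms by (intro mult_left_mono w_ge_1) auto
  also have "\<dots> \<le> wnorm f"
    using finite_sum_le_infsum[OF B_summable[OF assms(1)], of "{t}"] assms w_pos
    by (auto simp: wnorm_def less_imp_le)
  finally show ?thesis by simp
qed

text \<open>The functions that define bounded functionals on the Beurling algebra.\<close>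
definition wbounded :: "('a \<Rightarrow> complex) \<Rightarrow> bool" where
  "wbounded \<phi> \<longleftrightarrow> (\<exists>C. \<forall>t\<in>carrier G. cmod (\<phi> t) \<le> C * \<omega> t)"

text \<open>If \<open>\<phi>\<close> is regarded as a functional by means of \<open>f \<mapsto> \<Sum>\<^sub>\<infinity>r. \<phi> r * f r\<close>, then \<open>act \<phi> f\<close> is the functional
\<open>x \<mapsto> \<phi> (x f)\<close>, the action of the algebra on its dual.\<close>
definition act :: "('a \<Rightarrow> complex) \<Rightarrow> ('a \<Rightarrow> complex) \<Rightarrow> 'a \<Rightarrow> complex" where
  "act \<phi> f s = (\<Sum>\<^sub>\<infinity>r\<in>carrier G. \<phi> (s \<otimes> r) * f r)"

lemma wboundedE:
  assumes "wbounded \<phi>"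
  obtains C where "C \<ge> 0" "\<forall>t\<in>carrier G. cmod (\<phi> t) \<le> C * \<omega> t"
proof -
  obtain C where C: "\<forall>t\<in>carrier G. cmod (\<phi> t) \<le> C * \<omega> t"
    using assms by (auto simp: wbounded_def)
  have "cmod (\<phi> \<one>) \<le> C" using C one_closed w_one by force
  then have "0 \<le> C" using norm_ge_zero order_trans by blast
  with C that show thesis by blast
qed

lemma act_term_le:
  assumes C: "C \<ge> 0" "\<forall>t\<in>carrier G. cmod (\<phi> t) \<le> C * \<omega> t"
    and s: "s \<in> carrier G" and r: "r \<in> carrier G"
  shows "cmod (\<phi> (s \<otimes> r) * f r) \<le> C * \<omega> s * (cmod (f r) * \<omega> r)"
proof -
  have "cmod (\<phi> (s \<otimes> r)) \<le> C * \<omega> (s \<otimes> r)" using C s r by simp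
  also have "\<dots> \<le> C * (\<omega> s * \<omega> r)" using C s r by (intro mult_left_mono w_mult) auto
  finally have "cmod (\<phi> (s \<otimes> r)) * cmod (f r) \<le> C * (\<omega> s * \<omega> r) * cmod (f r)"
    by (rule mult_right_mono) simp
  then show ?thesis by (simp add: norm_mult mult_ac)
qed

lemma act_summable:
  assumes "wbounded \<phi>" "f \<in> carrier B" "s \<in> carrier G"
  shows "(\<lambda>r. \<phi> (s \<otimes> r) * f r) summable_on carrier G"
proof -
  obtain C where C: "C \<ge> 0" "\<forall>t\<in>carrier G. cmod (\<phi> t) \<le> C * \<omega> t"
    using wboundedE[OF assms(1)] by metis
  show ?thesis
  proof (rule dominated_infsum(2))
    show "(\<lambda>r. C * \<omega> s * (cmod (f r) * \<omega> r)) summable_on carrier G"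
      by (rule summable_on_cmult_right[OF B_summable[OF assms(2)]])
  qed (rule act_term_le[OF C assms(3)])
qed

lemma act_le:
  assumes C: "C \<ge> 0" "\<forall>t\<in>carrier G. cmod (\<phi> t) \<le> C * \<omega> t"
    and f: "f \<in> carrier B" and s: "s \<in> carrier G"
  shows "cmod (act \<phi> f s) \<le> C * wnorm f * \<omega> s"
proof -
  have "cmod (act \<phi> f s) \<le> (\<Sum>\<^sub>\<infinity>r\<in>carrier G. C * \<omega> s * (cmod (f r) * \<omega> r))"
    unfolding act_def
  proof (rule dominated_infsum(3))
    show "(\<lambda>r. C * \<omega> s * (cmod (f r) * \<omega> r)) summable_on carrier G"
      by (rule summable_on_cmult_right[OF B_summable[OF f]])
  qed (rule act_term_le[OF C s])
  also have "\<dots> = C * \<omega> s * wnorm f" unfolding wnorm_def by (rule infsum_cmult_right')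
  finally show ?thesis by (simp add: mult_ac)
qed

lemma act_add:
  assumes "wbounded \<phi>" "f \<in> carrier B" "g \<in> carrier B" "s \<in> carrier G"
  shows "act \<phi> (f \<oplus>\<^bsub>B\<^esub> g) s = act \<phi> f s + act \<phi> g s"
  unfolding act_def B_simps ring_distribs
  by (rule infsum_add[OF act_summable[OF assms(1,2,4)] act_summable[OF assms(1,3,4)]])

lemma act_smult: "act \<phi> (c \<odot>\<^bsub>B\<^esub> f) s = c * act \<phi> f s"
  unfolding act_def B_simps by (simp add: mult.left_commute[of _ c] infsum_cmult_right')

lemma act_one: "s \<in> carrier G \<Longrightarrow> act \<phi> \<one>\<^bsub>B\<^esub> s = \<phi> s"
  unfolding act_def B_simps
  by (subst infsum_cong_neutral[where T = "{\<one>}" and g = "\<lambda>r. \<phi> (s \<otimes> r)"]) auto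

lemma translate_wbounded:
  assumes "wbounded \<phi>" "s \<in> carrier G" shows "wbounded (\<lambda>t. \<phi> (s \<otimes> t))"
proof -
  obtain C where C: "C \<ge> 0" "\<forall>t\<in>carrier G. cmod (\<phi> t) \<le> C * \<omega> t"
    using wboundedE[OF assms(1)] by metis
  show ?thesis unfolding wbounded_def
    using act_term_le[OF C assms(2), of _ "\<lambda>_. 1"] by (intro exI[of _ "C * \<omega> s"]) simp
qed

text \<open>The terms are dominated by a multiple of the product of two summable families, because \<open>\<omega>\<close> is
submultiplicative.  This justifies all changes of the order of summation below.\<close>
lemma double_sum_summable:
  assumes x: "x \<in> carrier B" and f: "f \<in> carrier B" and \<phi>: "wbounded \<phi>"
  shows "(\<lambda>(s, r). \<phi> (s \<otimes> r) * (x s * f r)) abs_summable_on carrier G \<times> carrier G"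
proof -
  obtain C where C: "C \<ge> 0" "\<forall>t\<in>carrier G. cmod (\<phi> t) \<le> C * \<omega> t"
    using wboundedE[OF \<phi>] by metis
  define a where "a = (\<lambda>s. cmod (x s) * \<omega> s)"
  define b where "b = (\<lambda>r. cmod (f r) * \<omega> r)"
  have ab: "a summable_on carrier G" "b summable_on carrier G"
    using B_summable x f by (auto simp: a_def b_def)
  have nn: "s \<in> carrier G \<Longrightarrow> 0 \<le> a s" "s \<in> carrier G \<Longrightarrow> 0 \<le> b s" for s
    using w_pos[of s] by (auto simp: a_def b_def)
  have "(\<lambda>(s, r). C * a s * b r) summable_on carrier G \<times> carrier G"
  proof (rule summable_on_SigmaI)
    fix s assume "s \<in> carrier G"
    show "((\<lambda>r. case (s, r) of (s, r) \<Rightarrow> C * a s * b r) has_sum C * a s * infsum b (carrier G)) (carrier G)"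
      using has_sum_cmult_right[OF has_sum_infsum[OF ab(2)], of "C * a s"] by simp
  next
    show "(\<lambda>s. C * a s * infsum b (carrier G)) summable_on carrier G"
      using summable_on_cmult_right[OF ab(1), of "C * infsum b (carrier G)"] by (simp add: mult_ac)
  qed (use C nn in auto)
  then show ?thesis
  proof (rule dominated_infsum(1))
    fix p assume "p \<in> carrier G \<times> carrier G"
    then obtain s r where p: "p = (s, r)" "s \<in> carrier G" "r \<in> carrier G" by auto
    have "cmod (\<phi> (s \<otimes> r) * f r) * cmod (x s) \<le> C * \<omega> s * (cmod (f r) * \<omega> r) * cmod (x s)"
      by (intro mult_right_mono act_term_le[OF C] p) auto
    then show "cmod (case p of (s, r) \<Rightarrow> \<phi> (s \<otimes> r) * (x s * f r)) \<le> (case p of (s, r) \<Rightarrow> C * a s * b r)"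
      by (simp add: p norm_mult a_def b_def mult_ac)
  qed
qed

lemma left_div_bij: "bij_betw (\<lambda>(t, s). (s, inv s \<otimes> t)) (carrier G \<times> carrier G) (carrier G \<times> carrier G)"
  by (rule bij_betwI[where g = "\<lambda>(s, r). (s \<otimes> r, s)"]) (auto simp: m_assoc[symmetric])

lemma convolution_sum_summable:
  assumes "x \<in> carrier B" "f \<in> carrier B" "wbounded \<phi>"
  shows "(\<lambda>(t, s). \<phi> t * (x s * f (inv s \<otimes> t))) abs_summable_on carrier G \<times> carrier G"
proof -
  have "(\<lambda>p. cmod (case (case p of (t, s) \<Rightarrow> (s, inv s \<otimes> t)) of (s, r) \<Rightarrow> \<phi> (s \<otimes> r) * (x s * f r)))
      summable_on carrier G \<times> carrier G"
    using summable_on_reindex_bij_betw[OF left_div_bij,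
        of "\<lambda>p. cmod (case p of (s, r) \<Rightarrow> \<phi> (s \<otimes> r) * (x s * f r))"]
      double_sum_summable[OF assms] by simp
  then show ?thesis
    by (rule summable_on_cong[THEN iffD1, rotated]) (auto simp: m_assoc[symmetric])
qed

lemma mult_closed:
  assumes x: "x \<in> carrier B" and f: "f \<in> carrier B"
  shows "x \<otimes>\<^bsub>B\<^esub> f \<in> carrier B"
  unfolding B_mem
proof (intro conjI allI impI)
  have "wbounded (\<lambda>t. complex_of_real (\<omega> t))"
    unfolding wbounded_def by (intro exI[of _ 1]) (auto dest: w_pos)
  note s = convolution_sum_summable[OF x f this, unfolded abs_summable_on_Sigma_iff]
  define h where "h t = (\<Sum>\<^sub>\<infinity>s\<in>carrier G. cmod (complex_of_real (\<omega> t) * (x s * f (inv s \<otimes> t))))" for t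
  have h: "h summable_on carrier G"
  proof -
    have "(\<lambda>t. norm (h t)) summable_on carrier G" using s by (simp add: h_def)
    then show ?thesis by (rule abs_summable_summable)
  qed
  show "(\<lambda>t. cmod ((x \<otimes>\<^bsub>B\<^esub> f) t) * \<omega> t) summable_on carrier G"
  proof (rule summable_on_comparison_test[OF h])
    fix t assume t: "t \<in> carrier G"
    have "cmod ((x \<otimes>\<^bsub>B\<^esub> f) t) * \<omega> t = cmod (complex_of_real (\<omega> t) * (x \<otimes>\<^bsub>B\<^esub> f) t)"
      using w_pos[OF t] by (simp add: norm_mult)
    also have "complex_of_real (\<omega> t) * (x \<otimes>\<^bsub>B\<^esub> f) t
        = (\<Sum>\<^sub>\<infinity>s\<in>carrier G. complex_of_real (\<omega> t) * (x s * f (inv s \<otimes> t)))"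
      using t by (simp add: B_mult infsum_cmult_right')
    also have "cmod \<dots> \<le> h t"
      unfolding h_def using s t by (intro norm_infsum_bound) auto
    finally show "cmod ((x \<otimes>\<^bsub>B\<^esub> f) t) * \<omega> t \<le> h t" .
  qed (auto dest: w_pos)
qed (simp add: B_mult)

lemma pairing_mult:
  assumes x: "x \<in> carrier B" and f: "f \<in> carrier B" and \<phi>: "wbounded \<phi>"
  shows "(\<Sum>\<^sub>\<infinity>t\<in>carrier G. \<phi> t * (x \<otimes>\<^bsub>B\<^esub> f) t) = (\<Sum>\<^sub>\<infinity>s\<in>carrier G. x s * act \<phi> f s)"
proof -
  let ?F = "\<lambda>(s, r). \<phi> (s \<otimes> r) * (x s * f r)"
  let ?H = "\<lambda>(t, s). \<phi> t * (x s * f (inv s \<otimes> t))"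
  have F: "?F summable_on carrier G \<times> carrier G"
    by (rule abs_summable_summable[OF double_sum_summable[OF assms]])
  have H: "?H summable_on carrier G \<times> carrier G"
    by (rule abs_summable_summable[OF convolution_sum_summable[OF assms]])
  have "(\<Sum>\<^sub>\<infinity>t\<in>carrier G. \<phi> t * (x \<otimes>\<^bsub>B\<^esub> f) t)
      = (\<Sum>\<^sub>\<infinity>t\<in>carrier G. \<Sum>\<^sub>\<infinity>s\<in>carrier G. ?H (t, s))"
    by (intro infsum_cong) (simp add: B_mult infsum_cmult_right')
  also have "\<dots> = infsum ?H (carrier G \<times> carrier G)" by (rule infsum_Sigma_banach[OF H])
  also have "\<dots> = (\<Sum>\<^sub>\<infinity>p\<in>carrier G \<times> carrier G. ?F (case p of (t, s) \<Rightarrow> (s, inv s \<otimes> t)))"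
    by (rule infsum_cong) (auto simp: m_assoc[symmetric])
  also have "\<dots> = infsum ?F (carrier G \<times> carrier G)" by (rule infsum_reindex_bij_betw[OF left_div_bij])
  also have "\<dots> = (\<Sum>\<^sub>\<infinity>s\<in>carrier G. \<Sum>\<^sub>\<infinity>r\<in>carrier G. ?F (s, r))"
    by (rule infsum_Sigma_banach[OF F, symmetric])
  also have "\<dots> = (\<Sum>\<^sub>\<infinity>s\<in>carrier G. x s * act \<phi> f s)"
    by (intro infsum_cong) (simp add: act_def mult.left_commute[of _ "x _"] infsum_cmult_right')
  finally show ?thesis .
qed

lemma act_mult:
  assumes x: "x \<in> carrier B" and f: "f \<in> carrier B" and \<phi>: "wbounded \<phi>" and s: "s \<in> carrier G"
  shows "act \<phi> (x \<otimes>\<^bsub>B\<^esub> f) s = (\<Sum>\<^sub>\<infinity>u\<in>carrier G. x u * act \<phi> f (s \<otimes> u))"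
  unfolding act_def[of \<phi> "x \<otimes>\<^bsub>B\<^esub> f"]
  by (subst pairing_mult[OF x f translate_wbounded[OF \<phi> s]])
     (auto intro!: infsum_cong simp: act_def m_assoc s)

text \<open>Evaluation of a product at a point is itself a functional of the left factor, so that associativity
becomes a case of \<open>pairing_mult\<close>.\<close>
lemma mult_eval:
  "t \<in> carrier G \<Longrightarrow> (w \<otimes>\<^bsub>B\<^esub> z) t = (\<Sum>\<^sub>\<infinity>u\<in>carrier G. z (inv u \<otimes> t) * w u)"
  by (simp add: B_mult mult.commute)

lemma reflected_wbounded:
  assumes "z \<in> carrier B" "t \<in> carrier G" shows "wbounded (\<lambda>u. z (inv u \<otimes> t))"
proof -
  have "cmod (z (inv u \<otimes> t)) \<le> wnorm z * \<omega> u" if u: "u \<in> carrier G" for u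
  proof -
    have "cmod (z (inv u \<otimes> t)) \<le> wnorm z * 1" using cmod_le_wnorm[OF assms(1), of "inv u \<otimes> t"] u assms by simp
    also have "\<dots> \<le> wnorm z * \<omega> u" using wnorm_nonneg w_ge_1[OF u] by (intro mult_left_mono)
    finally show ?thesis .
  qed
  then show ?thesis by (auto simp: wbounded_def)
qed

lemma mult_assoc:
  assumes x: "x \<in> carrier B" and y: "y \<in> carrier B" and z: "z \<in> carrier B"
  shows "(x \<otimes>\<^bsub>B\<^esub> y) \<otimes>\<^bsub>B\<^esub> z = x \<otimes>\<^bsub>B\<^esub> (y \<otimes>\<^bsub>B\<^esub> z)"
proof
  fix t
  show "((x \<otimes>\<^bsub>B\<^esub> y) \<otimes>\<^bsub>B\<^esub> z) t = (x \<otimes>\<^bsub>B\<^esub> (y \<otimes>\<^bsub>B\<^esub> z)) t"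
  proof (cases "t \<in> carrier G")
    case True
    have "act (\<lambda>u. z (inv u \<otimes> t)) y s = (y \<otimes>\<^bsub>B\<^esub> z) (inv s \<otimes> t)" if s: "s \<in> carrier G" for s
      using s True unfolding act_def
      by (subst mult_eval) (auto intro!: infsum_cong simp: inv_mult_group m_assoc)
    then show ?thesis
      using pairing_mult[OF x y reflected_wbounded[OF z True]]
      by (simp only: mult_eval[OF True, of "x \<otimes>\<^bsub>B\<^esub> y"] B_mult[of x "y \<otimes>\<^bsub>B\<^esub> z"] True if_True)
        (auto intro!: infsum_cong)
  qed (simp add: B_mult)
qed

lemma convolution_summable:
  assumes "w \<in> carrier B" "z \<in> carrier B" "t \<in> carrier G"
  shows "(\<lambda>u. w u * z (inv u \<otimes> t)) summable_on carrier G"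
  using act_summable[OF reflected_wbounded[OF assms(2,3)] assms(1) one_closed]
  by (rule summable_on_cong[THEN iffD1, rotated]) (simp add: mult.commute)

lemma add_closed: "f \<in> carrier B \<Longrightarrow> g \<in> carrier B \<Longrightarrow> f \<oplus>\<^bsub>B\<^esub> g \<in> carrier B"
  unfolding B_mem B_simps
proof (intro conjI allI impI; (elim conjE)?)
  assume "(\<lambda>t. cmod (f t) * \<omega> t) summable_on carrier G" "(\<lambda>t. cmod (g t) * \<omega> t) summable_on carrier G"
  then have *: "(\<lambda>t. cmod (f t) * \<omega> t + cmod (g t) * \<omega> t) summable_on carrier G" by (rule summable_on_add)
  show "(\<lambda>t. cmod (f t + g t) * \<omega> t) summable_on carrier G"
  proof (rule summable_on_comparison_test[OF *])
    fix t assume t: "t \<in> carrier G"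
    have "cmod (f t + g t) * \<omega> t \<le> (cmod (f t) + cmod (g t)) * \<omega> t"
      using w_pos[OF t] by (intro mult_right_mono norm_triangle_ineq) auto
    then show "cmod (f t + g t) * \<omega> t \<le> cmod (f t) * \<omega> t + cmod (g t) * \<omega> t"
      by (simp add: algebra_simps)
  qed (auto dest: w_pos)
qed simp

lemma smult_closed: "f \<in> carrier B \<Longrightarrow> c \<odot>\<^bsub>B\<^esub> f \<in> carrier B"
  unfolding B_mem B_simps using summable_on_cmult_right[of "\<lambda>t. cmod (f t) * \<omega> t" "carrier G" "cmod c"]
  by (auto simp: norm_mult mult_ac)

lemma zero_closed: "\<zero>\<^bsub>B\<^esub> \<in> carrier B" by (simp add: B_mem B_simps)

lemma one_in_B: "\<one>\<^bsub>B\<^esub> \<in> carrier B"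
proof -
  have "(\<lambda>t. cmod (if t = \<one> then 1 else 0) * \<omega> t) summable_on carrier G \<longleftrightarrow>
      (\<lambda>t. \<omega> t) summable_on {\<one>}"
    by (rule summable_on_cong_neutral) auto
  then show ?thesis by (auto simp: B_mem B_simps)
qed

lemma B_abelian_group: "abelian_group B"
proof (rule abelian_groupI)
  fix x assume x: "x \<in> carrier B"
  then show "\<exists>y\<in>carrier B. y \<oplus>\<^bsub>B\<^esub> x = \<zero>\<^bsub>B\<^esub>"
    using smult_closed[OF x, of "-1"] by (intro bexI[of _ "(- 1) \<odot>\<^bsub>B\<^esub> x"]) (auto simp: B_simps)
qed (auto simp: add_closed zero_closed, auto simp: B_simps)

lemma B_ring: "ring B"
proof (rule ringI)
  show "abelian_group B" by (rule B_abelian_group)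
  show "Group.monoid B"
  proof
    fix x assume x: "x \<in> carrier B"
    show "\<one>\<^bsub>B\<^esub> \<otimes>\<^bsub>B\<^esub> x = x"
    proof
      fix t show "(\<one>\<^bsub>B\<^esub> \<otimes>\<^bsub>B\<^esub> x) t = x t"
      proof (cases "t \<in> carrier G")
        case True
        have "(\<Sum>\<^sub>\<infinity>s\<in>carrier G. (if s = \<one> then 1 else 0) * x (inv s \<otimes> t))
            = (\<Sum>\<^sub>\<infinity>s\<in>{\<one>}. x (inv s \<otimes> t))"
          by (rule infsum_cong_neutral) auto
        then show ?thesis using True by (simp add: B_mult B_simps)
      qed (use x in \<open>simp add: B_mult B_mem\<close>)
    qed
    show "x \<otimes>\<^bsub>B\<^esub> \<one>\<^bsub>B\<^esub> = x"
    proof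
      fix t show "(x \<otimes>\<^bsub>B\<^esub> \<one>\<^bsub>B\<^esub>) t = x t"
      proof (cases "t \<in> carrier G")
        case True
        have "inv s \<otimes> t = \<one> \<longleftrightarrow> s = t" if "s \<in> carrier G" for s
          using that True inv_equality inv_solve_left' by fastforce
        then have "(\<Sum>\<^sub>\<infinity>s\<in>carrier G. x s * (if inv s \<otimes> t = \<one> then 1 else 0)) = (\<Sum>\<^sub>\<infinity>s\<in>{t}. x s)"
          using True by (intro infsum_cong_neutral) auto
        then show ?thesis using True by (simp add: B_mult B_simps)
      qed (use x in \<open>simp add: B_mult B_mem\<close>)
    qed
  qed (auto simp: mult_closed mult_assoc one_in_B)
next
  fix x y z assume x: "x \<in> carrier B" and y: "y \<in> carrier B" and z: "z \<in> carrier B"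
  show "(x \<oplus>\<^bsub>B\<^esub> y) \<otimes>\<^bsub>B\<^esub> z = x \<otimes>\<^bsub>B\<^esub> z \<oplus>\<^bsub>B\<^esub> y \<otimes>\<^bsub>B\<^esub> z"
  proof
    fix t show "((x \<oplus>\<^bsub>B\<^esub> y) \<otimes>\<^bsub>B\<^esub> z) t = (x \<otimes>\<^bsub>B\<^esub> z \<oplus>\<^bsub>B\<^esub> y \<otimes>\<^bsub>B\<^esub> z) t"
      using infsum_add[OF convolution_summable[OF x z, of t] convolution_summable[OF y z, of t]]
      by (cases "t \<in> carrier G") (simp_all add: B_simps B_mult distrib_right)
  qed
  show "z \<otimes>\<^bsub>B\<^esub> (x \<oplus>\<^bsub>B\<^esub> y) = z \<otimes>\<^bsub>B\<^esub> x \<oplus>\<^bsub>B\<^esub> z \<otimes>\<^bsub>B\<^esub> y"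
  proof
    fix t show "(z \<otimes>\<^bsub>B\<^esub> (x \<oplus>\<^bsub>B\<^esub> y)) t = (z \<otimes>\<^bsub>B\<^esub> x \<oplus>\<^bsub>B\<^esub> z \<otimes>\<^bsub>B\<^esub> y) t"
      using infsum_add[OF convolution_summable[OF z x, of t] convolution_summable[OF z y, of t]]
      by (cases "t \<in> carrier G") (simp_all add: B_simps B_mult distrib_left)
  qed
qed

lemma B_complex_algebra: "complex_algebra B"
proof (intro complex_algebra.intro complex_algebra_axioms.intro)
  show "module (ring_of_type_algebra :: complex ring) B"
    by (rule moduleI[OF cring_from_type_algebra B_abelian_group])
       (auto simp: smult_closed ring_of_type_algebra_def, auto simp: B_simps algebra_simps)
  show "ring B" by (rule B_ring)
  fix x y c
  show "(c \<odot>\<^bsub>B\<^esub> x) \<otimes>\<^bsub>B\<^esub> y = c \<odot>\<^bsub>B\<^esub> (x \<otimes>\<^bsub>B\<^esub> y)"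
    by (rule ext) (simp add: B_mult B_simps mult.assoc infsum_cmult_right')
qed

end

section \<open>A left ideal of finite codimension\<close>

locale finite_index_character = weighted_group G \<omega> for G (structure) and \<omega> +
  fixes H :: "'a set" and \<chi> :: "'a \<Rightarrow> real"
  assumes H: "subgroup H G" and fin_index: "finite (rcosets H)"
    and chi_pos: "x \<in> H \<Longrightarrow> 0 < \<chi> x" and chi_le: "x \<in> H \<Longrightarrow> \<chi> x \<le> \<omega> x"
    and chi_mult: "x \<in> H \<Longrightarrow> y \<in> H \<Longrightarrow> \<chi> (x \<otimes> y) = \<chi> x * \<chi> y"
begin

lemma H_carrier: "h \<in> H \<Longrightarrow> h \<in> carrier G" using subgroup.subset[OF H] by blast

lemma H_mult_iff:
  assumes "h \<in> H" "y \<in> carrier G" shows "h \<otimes> y \<in> H \<longleftrightarrow> y \<in> H"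
proof
  assume "h \<otimes> y \<in> H"
  then have "inv h \<otimes> (h \<otimes> y) \<in> H" using assms H by (simp add: subgroup.m_closed subgroup.m_inv_closed)
  then show "y \<in> H" using assms H_carrier by (simp add: m_assoc[symmetric])
qed (use assms H in \<open>simp add: subgroup.m_closed\<close>)

lemma transversal: "\<exists>T. finite T \<and> T \<subseteq> carrier G \<and> (\<forall>s\<in>carrier G. \<exists>h\<in>H. \<exists>t\<in>T. s = h \<otimes> t)"
proof -
  define p where "p c = (SOME a. a \<in> carrier G \<and> c = H #> a)" for c
  have p: "p c \<in> carrier G \<and> c = H #> p c" if "c \<in> rcosets H" for c
    unfolding p_def by (rule someI_ex) (use that in \<open>auto simp: RCOSETS_def\<close>)
  have "\<exists>h\<in>H. \<exists>t\<in>p ` (rcosets H). s = h \<otimes> t" if s: "s \<in> carrier G" for s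
  proof -
    have c: "H #> s \<in> rcosets H" using s by (auto simp: RCOSETS_def)
    have "s \<in> H #> s" using rcos_self[OF s H] .
    then have "s \<in> H #> p (H #> s)" using p[OF c] by simp
    then obtain h where "h \<in> H" "s = h \<otimes> p (H #> s)" by (auto simp: r_coset_def)
    with c show ?thesis by blast
  qed
  then show ?thesis using fin_index p by (intro exI[of _ "p ` (rcosets H)"]) auto
qed

text \<open>The character, extended by zero to \<open>G\<close>.\<close>
definition \<Phi> :: "'a \<Rightarrow> complex" where "\<Phi> t = (if t \<in> H then complex_of_real (\<chi> t) else 0)"

lemma Phi_le: "\<forall>t\<in>carrier G. cmod (\<Phi> t) \<le> 1 * \<omega> t"
  using chi_pos chi_le w_pos by (auto simp: \<Phi>_def less_imp_le)

lemma Phi_wbounded: "wbounded \<Phi>" unfolding wbounded_def using Phi_le by blast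

lemma Phi_mult: "h \<in> H \<Longrightarrow> y \<in> carrier G \<Longrightarrow> \<Phi> (h \<otimes> y) = \<chi> h * \<Phi> y"
  by (simp add: \<Phi>_def H_mult_iff chi_mult)

lemma act_Phi_shift:
  assumes "h \<in> H" "s \<in> carrier G" shows "act \<Phi> f (h \<otimes> s) = \<chi> h * act \<Phi> f s"
proof -
  have "act \<Phi> f (h \<otimes> s) = (\<Sum>\<^sub>\<infinity>r\<in>carrier G. \<chi> h * (\<Phi> (s \<otimes> r) * f r))"
    unfolding act_def using assms H_carrier
    by (intro infsum_cong) (simp add: m_assoc Phi_mult)
  then show ?thesis unfolding act_def by (simp add: infsum_cmult_right')
qed

text \<open>The condition at \<open>s\<close> is the vanishing of the sum of \<open>f (t h) \<chi> h\<close> over \<open>h \<in> H\<close>, where \<open>t\<close> is the inverse of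
\<open>s\<close>.\<close>
definition L :: "('a \<Rightarrow> complex) set" where "L = {f \<in> carrier B. \<forall>s\<in>carrier G. act \<Phi> f s = 0}"

lemma L_left_ideal: "left_ideal L B"
proof -
  interpret C: complex_algebra B by (rule B_complex_algebra)
  show ?thesis
  proof (rule C.left_idealI)
    show "\<zero>\<^bsub>B\<^esub> \<in> L" by (simp add: L_def zero_closed act_def) (simp add: B_simps)
  next
    fix f g assume "f \<in> L" "g \<in> L"
    then show "f \<oplus>\<^bsub>B\<^esub> g \<in> L" by (simp add: L_def add_closed act_add[OF Phi_wbounded])
  next
    fix x f assume "x \<in> carrier B" "f \<in> L"
    then show "x \<otimes>\<^bsub>B\<^esub> f \<in> L"
      by (auto simp: L_def mult_closed act_mult[OF _ _ Phi_wbounded] intro!: infsum_0)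
  qed (auto simp: L_def)
qed

text \<open>By \<open>act_Phi_shift\<close> the condition at \<open>s\<close> depends only on the coset \<open>H s\<close>, so that finitely many linear conditions
suffice.\<close>
lemma L_codim: "\<exists>n. complex_algebra.codim_le B L n"
proof -
  interpret C: complex_algebra B by (rule B_complex_algebra)
  obtain T where T: "finite T" "T \<subseteq> carrier G" "\<And>s. s \<in> carrier G \<Longrightarrow> \<exists>h\<in>H. \<exists>t\<in>T. s = h \<otimes> t"
    using transversal by metis
  have "L = {f \<in> carrier B. \<forall>t\<in>T. act \<Phi> f t = 0}"
  proof (intro equalityI subsetI)
    fix f assume f: "f \<in> {f \<in> carrier B. \<forall>t\<in>T. act \<Phi> f t = 0}"
    have "act \<Phi> f s = 0" if "s \<in> carrier G" for s
    proof -
      obtain h t where "h \<in> H" "t \<in> T" "s = h \<otimes> t" using T(3) \<open>s \<in> carrier G\<close> by blast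
      with f T(2) show ?thesis by (simp add: act_Phi_shift subset_iff)
    qed
    with f show "f \<in> L" by (simp add: L_def)
  qed (use T(2) in \<open>auto simp: L_def\<close>)
  moreover have "C.codim_le {f \<in> carrier B. \<forall>t\<in>T. act \<Phi> f t = 0} (card T)"
  proof (rule C.codim_le_kernels[OF T(1)])
    fix t f g assume "t \<in> T" "f \<in> carrier B" "g \<in> carrier B"
    then show "act \<Phi> (f \<oplus>\<^bsub>B\<^esub> g) t = act \<Phi> f t + act \<Phi> g t"
      using T(2) by (intro act_add[OF Phi_wbounded]) auto
  qed (rule act_smult)
  ultimately show ?thesis by auto
qed

definition ext :: "('a \<Rightarrow> real) \<Rightarrow> 'a \<Rightarrow> complex" where
  "ext \<phi> x = (if x \<in> H then complex_of_real (\<phi> x) else 0)"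

lemma tail_small:
  assumes f: "f \<in> carrier B" and d: "d > 0"
  shows "\<exists>E. finite E \<and> E \<subseteq> carrier G \<and>
    (\<lambda>r. if r \<in> E then 0 else cmod (f r) * \<omega> r) summable_on carrier G \<and>
    (\<Sum>\<^sub>\<infinity>r\<in>carrier G. if r \<in> E then 0 else cmod (f r) * \<omega> r) \<le> d"
proof -
  let ?g = "\<lambda>r. cmod (f r) * \<omega> r"
  have g: "?g summable_on carrier G" by (rule B_summable[OF f])
  obtain E where E: "finite E" "E \<subseteq> carrier G" "dist (sum ?g E) (infsum ?g (carrier G)) \<le> d"
    using infsum_finite_approximation[OF g d] by blast
  have ind: "((\<lambda>r. if r \<in> E then - ?g r else 0) has_sum (- sum ?g E)) (carrier G)"
    using E(1,2) by (intro has_sum_finite_neutralI) (auto simp: sum_negf intro!: sum.cong)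
  have "((\<lambda>r. ?g r + (if r \<in> E then - ?g r else 0)) has_sum (infsum ?g (carrier G) + - sum ?g E)) (carrier G)"
    by (rule has_sum_add[OF has_sum_infsum[OF g] ind])
  moreover have "(\<lambda>r. ?g r + (if r \<in> E then - ?g r else 0)) = (\<lambda>r. if r \<in> E then 0 else ?g r)" by auto
  ultimately have "((\<lambda>r. if r \<in> E then 0 else ?g r) has_sum (infsum ?g (carrier G) - sum ?g E)) (carrier G)"
    by simp
  then show ?thesis using E by (intro exI[of _ E]) (auto simp: summable_on_def infsumI dist_real_def)
qed

text \<open>As \<open>f\<close> lies in \<open>L\<close>, subtracting \<open>\<phi> h\<close> times the extended character from the function \<open>y \<mapsto> \<phi> (h y)\<close> does
not change the value at \<open>t\<close> of its action on \<open>f\<close>.  On finitely many points the difference is small because \<open>\<phi>\<close> is almost an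
eigenfunction, and elsewhere \<open>f\<close> is small.  The set \<open>F\<close> and the tolerance \<open>\<delta>\<close> depend on \<open>f\<close> but not on
\<open>\<phi>\<close>, which is what allows \<open>\<phi>\<close> to be chosen afterwards.\<close>
lemma act_almost_zero:
  assumes f: "f \<in> L" and T: "finite T" "T \<subseteq> carrier G" and d: "d > 0"
  shows "\<exists>F \<delta>. finite F \<and> F \<subseteq> H \<and> \<delta> > 0 \<and> (\<forall>\<phi> e.
      (\<forall>x\<in>H. 0 \<le> \<phi> x \<and> \<phi> x \<le> \<omega> x) \<and> (\<forall>x\<in>H. \<forall>y\<in>F. \<bar>\<phi> (x \<otimes> y) - \<chi> y * \<phi> x\<bar> \<le> \<delta> * \<omega> x)
      \<longrightarrow> (\<forall>h\<in>H. \<forall>t\<in>T. cmod (act (ext \<phi>) f (h \<otimes> t)) \<le> d * \<omega> h))"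
proof -
  have fB: "f \<in> carrier B" using f by (simp add: L_def)
  define M where "M = 1 + sum \<omega> T"
  have M: "\<omega> t \<le> M" if "t \<in> T" for t
  proof -
    have "\<omega> t \<le> sum \<omega> T"
      by (rule member_le_sum[OF that _ T(1)]) (use T(2) w_pos in \<open>auto simp: less_imp_le subset_iff\<close>)
    then show ?thesis by (simp add: M_def)
  qed
  have M1: "M \<ge> 1" unfolding M_def using T w_pos by (auto intro!: sum_nonneg simp: less_imp_le subset_iff)
  have "d / (4 * M) > 0" using d M1 by simp
  from tail_small[OF fB this] obtain E where E: "finite E" "E \<subseteq> carrier G"
    and Es: "(\<lambda>r. if r \<in> E then 0 else cmod (f r) * \<omega> r) summable_on carrier G"
    and Ed: "(\<Sum>\<^sub>\<infinity>r\<in>carrier G. if r \<in> E then 0 else cmod (f r) * \<omega> r) \<le> d / (4 * M)"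
    by blast
  define F where "F = (\<lambda>(t, r). t \<otimes> r) ` (T \<times> E) \<inter> H"
  \<comment> \<open>The points of \<open>E\<close> and the tail outside \<open>E\<close> are each allotted \<open>d / 2\<close>.\<close>
  define \<delta> where "\<delta> = d / (2 * (1 + wnorm f))"
  have N: "1 + wnorm f > 0" using wnorm_nonneg[of f] by simp
  have \<delta>: "\<delta> > 0" unfolding \<delta>_def using N d by simp
  have main: "cmod (act (ext \<phi>) f (h \<otimes> t)) \<le> d * \<omega> h"
    if \<phi>: "\<forall>x\<in>H. 0 \<le> \<phi> x \<and> \<phi> x \<le> \<omega> x" "\<forall>x\<in>H. \<forall>y\<in>F. \<bar>\<phi> (x \<otimes> y) - \<chi> y * \<phi> x\<bar> \<le> \<delta> * \<omega> x"
      and h: "h \<in> H" and t: "t \<in> T" for \<phi> h t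
  proof -
    define \<phi>' where "\<phi>' = ext \<phi>"
    have tG: "t \<in> carrier G" and hG: "h \<in> carrier G" using t T h H_carrier by auto
    have "\<forall>x\<in>carrier G. cmod (\<phi>' x) \<le> 1 * \<omega> x" using \<phi>(1) w_pos by (auto simp: \<phi>'_def ext_def less_imp_le)
    then have \<phi>'_bd: "wbounded \<phi>'" unfolding wbounded_def by blast
    \<comment> \<open>The error of \<open>\<phi>\<close> as an eigenfunction at \<open>h\<close>; it vanishes unless \<open>t r \<in> H\<close>.\<close>
    define D where "D r = \<phi>' (h \<otimes> t \<otimes> r) - \<phi> h * \<Phi> (t \<otimes> r)" for r
    have s1: "(\<lambda>r. \<phi>' (h \<otimes> t \<otimes> r) * f r) summable_on carrier G"
      using hG tG by (intro act_summable[OF \<phi>'_bd fB]) auto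
    have s2: "(\<lambda>r. - (\<phi> h) * (\<Phi> (t \<otimes> r) * f r)) summable_on carrier G"
      by (intro summable_on_cmult_right act_summable[OF Phi_wbounded fB tG])
    have "(\<Sum>\<^sub>\<infinity>r\<in>carrier G. D r * f r)
        = act \<phi>' f (h \<otimes> t) + (\<Sum>\<^sub>\<infinity>r\<in>carrier G. - (\<phi> h) * (\<Phi> (t \<otimes> r) * f r))"
      unfolding act_def infsum_add[OF s1 s2, symmetric]
      by (intro infsum_cong) (simp add: D_def algebra_simps)
    also have "(\<Sum>\<^sub>\<infinity>r\<in>carrier G. - (\<phi> h) * (\<Phi> (t \<otimes> r) * f r)) = - (\<phi> h) * act \<Phi> f t"
      unfolding act_def by (rule infsum_cmult_right')
    also have "act \<Phi> f t = 0" using f tG by (simp add: L_def)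
    finally have eq: "act \<phi>' f (h \<otimes> t) = (\<Sum>\<^sub>\<infinity>r\<in>carrier G. D r * f r)" by simp
    define g where "g r = \<delta> * \<omega> h * (cmod (f r) * \<omega> r) +
        2 * \<omega> h * M * (if r \<in> E then 0 else cmod (f r) * \<omega> r)" for r
    have gs: "g summable_on carrier G" unfolding g_def
      by (intro summable_on_add summable_on_cmult_right B_summable[OF fB] Es)
    have wh: "\<omega> h > 0" by (rule w_pos[OF hG])
    have le: "cmod (D r * f r) \<le> g r" if r: "r \<in> carrier G" for r
    proof -
      have wr: "\<omega> r \<ge> 1" by (rule w_ge_1[OF r])
      have g0: "0 \<le> \<delta> * \<omega> h * (cmod (f r) * \<omega> r)" "0 \<le> 2 * \<omega> h * M * (cmod (f r) * \<omega> r)"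
        using \<delta> wh wr M1 by (auto intro!: mult_nonneg_nonneg)
      define y where "y = t \<otimes> r"
      have y: "y \<in> carrier G" using tG r by (simp add: y_def)
      have hy: "h \<otimes> t \<otimes> r = h \<otimes> y" using hG tG r by (simp add: y_def m_assoc)
      show ?thesis
      proof (cases "y \<in> H")
        case False
        then have "D r = 0" using H_mult_iff[OF h y] by (simp add: D_def hy \<phi>'_def ext_def \<Phi>_def y_def)
        then show ?thesis using g0 by (simp add: g_def)
      next
        case True
        then have hyH: "h \<otimes> y \<in> H" using H_mult_iff[OF h y] by simp
        have "D r = complex_of_real (\<phi> (h \<otimes> y) - \<chi> y * \<phi> h)"
          unfolding D_def hy using True hyH by (simp add: \<phi>'_def ext_def \<Phi>_def y_def mult.commute)
        then have D: "cmod (D r) = \<bar>\<phi> (h \<otimes> y) - \<chi> y * \<phi> h\<bar>" by (simp only: norm_of_real)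
        show ?thesis
        proof (cases "r \<in> E")
          case True
          then have "y \<in> F" using t \<open>y \<in> H\<close> by (auto simp: F_def y_def)
          then have "cmod (D r) \<le> \<delta> * \<omega> h" using \<phi>(2) h D by simp
          then have "cmod (D r) * cmod (f r) \<le> \<delta> * \<omega> h * cmod (f r)" by (rule mult_right_mono) simp
          also have "\<dots> \<le> \<delta> * \<omega> h * (cmod (f r) * \<omega> r)"
            using wr \<delta> wh mult_left_mono[OF wr, of "cmod (f r)"] by (intro mult_left_mono) auto
          finally show ?thesis using True by (simp add: g_def norm_mult)
        next
          case False
          have wy: "\<omega> y \<le> M * \<omega> r"
          proof -
            have "\<omega> y \<le> \<omega> t * \<omega> r" unfolding y_def by (rule w_mult[OF tG r])
            also have "\<dots> \<le> M * \<omega> r" using M[OF t] wr by (intro mult_right_mono) auto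
            finally show ?thesis .
          qed
          have a: "0 \<le> \<phi> (h \<otimes> y)" "\<phi> (h \<otimes> y) \<le> \<omega> h * \<omega> y"
            using \<phi>(1) hyH w_mult[OF hG y] by force+
          have b: "0 \<le> \<chi> y * \<phi> h" "\<chi> y * \<phi> h \<le> \<omega> y * \<omega> h"
            using \<phi>(1) h chi_pos[OF \<open>y \<in> H\<close>] chi_le[OF \<open>y \<in> H\<close>] w_pos[OF y]
            by (auto intro!: mult_mono mult_nonneg_nonneg simp: less_imp_le)
          have "\<bar>\<phi> (h \<otimes> y) - \<chi> y * \<phi> h\<bar> \<le> \<omega> h * \<omega> y + \<omega> y * \<omega> h" using a b by linarith
          also have "\<dots> = 2 * \<omega> h * \<omega> y" by simp
          also have "\<dots> \<le> 2 * \<omega> h * (M * \<omega> r)" using wy wh by (intro mult_left_mono) auto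
          finally have "cmod (D r) * cmod (f r) \<le> 2 * \<omega> h * (M * \<omega> r) * cmod (f r)"
            unfolding D by (rule mult_right_mono) simp
          also have "\<dots> = 2 * \<omega> h * M * (cmod (f r) * \<omega> r)" by (simp only: mult_ac)
          finally show ?thesis using False g0 by (simp add: g_def norm_mult)
        qed
      qed
    qed
    have "cmod (act \<phi>' f (h \<otimes> t)) \<le> infsum g (carrier G)"
      unfolding eq by (rule dominated_infsum(3)[OF gs le])
    also have "infsum g (carrier G) = \<delta> * \<omega> h * wnorm f +
        2 * \<omega> h * M * (\<Sum>\<^sub>\<infinity>r\<in>carrier G. if r \<in> E then 0 else cmod (f r) * \<omega> r)"
      unfolding g_def wnorm_def
      by (subst infsum_add) (auto intro!: summable_on_cmult_right B_summable[OF fB] Es simp: infsum_cmult_right')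
    also have "\<dots> \<le> \<omega> h * (d / 2) + 2 * \<omega> h * M * (d / (4 * M))"
    proof (rule add_mono)
      have "\<delta> * wnorm f \<le> \<delta> * (1 + wnorm f)" using \<delta> by simp
      also have "\<dots> = d / 2" using N by (simp add: \<delta>_def field_simps)
      finally have "\<omega> h * (\<delta> * wnorm f) \<le> \<omega> h * (d / 2)" using wh by simp
      then show "\<delta> * \<omega> h * wnorm f \<le> \<omega> h * (d / 2)" by (simp only: mult_ac)
      show "2 * \<omega> h * M * (\<Sum>\<^sub>\<infinity>r\<in>carrier G. if r \<in> E then 0 else cmod (f r) * \<omega> r)
          \<le> 2 * \<omega> h * M * (d / (4 * M))" using Ed wh M1 by (intro mult_left_mono) auto
    qed
    also have "\<dots> = d * \<omega> h" using M1 by (simp add: field_simps)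
    finally show ?thesis unfolding \<phi>'_def .
  qed
  show ?thesis
    by (intro exI[of _ F] exI[of _ \<delta>] conjI allI impI ballI main \<delta>)
       (use E T in \<open>auto simp: F_def\<close>)
qed


section \<open>Failure of finite generation\<close>

lemma ext_bound:
  assumes "\<forall>x\<in>H. 0 \<le> \<phi> x \<and> \<phi> x \<le> \<omega> x"
  shows "\<forall>x\<in>carrier G. cmod (ext \<phi> x) \<le> 1 * \<omega> x"
  using assms w_pos by (auto simp: ext_def less_imp_le)

text \<open>A point \<open>s\<close> of \<open>G\<close> is written \<open>h t\<close> with \<open>t\<close> in a finite transversal; passing from \<open>\<omega> h\<close> to \<open>\<omega> s\<close> costs the
factor \<open>M\<close>, which is built into the tolerance \<open>d\<close>.\<close>
lemma exists_almost_annihilating: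
  assumes sep: "has_peaked_almost_eigenfunctions (G\<lparr>carrier := H\<rparr>) \<omega> \<chi>"
    and S: "finite S" "S \<subseteq> L" and e: "e > 0"
  shows "\<exists>\<phi> q. q \<in> H \<and> (\<forall>x\<in>H. 0 \<le> \<phi> x \<and> \<phi> x \<le> \<omega> x) \<and> \<phi> \<one> = 0 \<and> \<omega> q \<le> 4 * \<phi> q \<and>
    (\<forall>f\<in>S. \<forall>s\<in>carrier G. cmod (act (ext \<phi>) f s) \<le> e * \<omega> s)"
proof -
  obtain T where T: "finite T" "T \<subseteq> carrier G" "\<And>s. s \<in> carrier G \<Longrightarrow> \<exists>h\<in>H. \<exists>t\<in>T. s = h \<otimes> t"
    using transversal by metis
  define M where "M = 1 + (\<Sum>t\<in>T. \<omega> (inv t))"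
  have inv_pos: "0 \<le> \<omega> (inv t)" if "t \<in> T" for t
    using w_pos[of "inv t"] T(2) that by (auto simp: less_imp_le subset_iff)
  have M: "\<omega> (inv t) \<le> M" if "t \<in> T" for t
    using member_le_sum[OF that, of "\<lambda>t. \<omega> (inv t)"] inv_pos T(1) by (simp add: M_def)
  have M1: "M > 0" unfolding M_def using sum_nonneg[of T "\<lambda>t. \<omega> (inv t)"] inv_pos by simp
  define d where "d = e / M"
  have d: "d > 0" using e M1 by (simp add: d_def)
  define P where "P f F \<delta> \<longleftrightarrow> finite F \<and> F \<subseteq> H \<and> \<delta> > 0 \<and> (\<forall>\<phi>.
      (\<forall>x\<in>H. 0 \<le> \<phi> x \<and> \<phi> x \<le> \<omega> x) \<and> (\<forall>x\<in>H. \<forall>y\<in>F. \<bar>\<phi> (x \<otimes> y) - \<chi> y * \<phi> x\<bar> \<le> \<delta> * \<omega> x)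
      \<longrightarrow> (\<forall>h\<in>H. \<forall>t\<in>T. cmod (act (ext \<phi>) f (h \<otimes> t)) \<le> d * \<omega> h))" for f F \<delta>
  have "\<forall>f\<in>S. \<exists>F \<delta>. P f F \<delta>"
  proof
    fix f assume "f \<in> S"
    then have "f \<in> L" using S by blast
    from act_almost_zero[OF this T(1,2) d] show "\<exists>F \<delta>. P f F \<delta>"
      unfolding P_def by simp
  qed
  then obtain F \<delta> where F: "\<And>f. f \<in> S \<Longrightarrow> P f (F f) (\<delta> f)" by metis
  define F' where "F' = (\<Union>f\<in>S. F f)"
  define \<delta>' where "\<delta>' = Min (insert 1 (\<delta> ` S))"
  have FD: "finite (F f)" "F f \<subseteq> H" "\<delta> f > 0" if "f \<in> S" for f
    using F[OF that] unfolding P_def by blast+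
  have F': "finite F'" "F' \<subseteq> H" unfolding F'_def using FD(1,2) S(1) by blast+
  have \<delta>': "\<delta>' > 0" using FD(3) S(1) by (simp add: \<delta>'_def)
  have \<delta>'_le: "\<delta>' \<le> \<delta> f" if "f \<in> S" for f using S(1) that by (auto simp: \<delta>'_def)
  obtain \<phi> q where q: "q \<in> H" and \<phi>: "\<forall>x\<in>H. 0 \<le> \<phi> x \<and> \<phi> x \<le> \<omega> x" "\<phi> \<one> = 0" "\<omega> q \<le> 4 * \<phi> q"
    "\<forall>x\<in>H. \<forall>h\<in>F'. \<bar>\<phi> (x \<otimes> h) - \<chi> h * \<phi> x\<bar> \<le> \<delta>' * \<omega> x"
    using sep[unfolded has_peaked_almost_eigenfunctions_def, rule_format, of F' \<delta>'] F' \<delta>' by auto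
  have "cmod (act (ext \<phi>) f s) \<le> e * \<omega> s" if f: "f \<in> S" and s: "s \<in> carrier G" for f s
  proof -
    obtain h t where ht: "h \<in> H" "t \<in> T" "s = h \<otimes> t" using T(3)[OF s] by blast
    have tG: "t \<in> carrier G" and hG: "h \<in> carrier G" using ht T(2) H_carrier by auto
    have "\<bar>\<phi> (x \<otimes> y) - \<chi> y * \<phi> x\<bar> \<le> \<delta> f * \<omega> x" if "x \<in> H" "y \<in> F f" for x y
    proof -
      have "\<bar>\<phi> (x \<otimes> y) - \<chi> y * \<phi> x\<bar> \<le> \<delta>' * \<omega> x" using \<phi>(4) that f by (auto simp: F'_def)
      also have "\<dots> \<le> \<delta> f * \<omega> x"
        using \<delta>'_le[OF f] w_pos[OF H_carrier[OF that(1)]] by (intro mult_right_mono) auto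
      finally show ?thesis .
    qed
    then have act_le: "cmod (act (ext \<phi>) f s) \<le> d * \<omega> h"
      using F[OF f] \<phi>(1) ht unfolding P_def by blast
    have "\<omega> h \<le> \<omega> s * \<omega> (inv t)"
      using w_mult[of s "inv t"] tG hG by (simp add: ht m_assoc)
    also have "\<dots> \<le> \<omega> s * M" using w_pos[OF s] by (intro mult_left_mono M ht) auto
    finally have "d * \<omega> h \<le> d * (\<omega> s * M)" using d by (intro mult_left_mono) auto
    also have "\<dots> = e * \<omega> s" using M1 by (simp add: d_def)
    finally show ?thesis using act_le by (rule order_trans[rotated])
  qed
  with q \<phi> show ?thesis by blast
qed

text \<open>The points \<open>q k\<close> may repeat.  Giving each of them only the coefficient that belongs to its first
occurrence keeps the sum of the weighted coefficients below the geometric series, and loses nothing since the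
coefficients decrease.\<close>
lemma exists_summable_peaks:
  assumes q: "\<And>k::nat. q k \<in> H" "\<And>k. q k \<noteq> \<one>"
  shows "\<exists>p. p \<in> carrier B \<and> (\<forall>t. t \<notin> H - {\<one>} \<longrightarrow> p t = 0) \<and>
    (\<forall>t. \<exists>r\<ge>0. p t = complex_of_real r) \<and>
    (\<forall>k. (1/2) ^ k / \<omega> (q k) \<le> Re (p (q k)))"
proof -
  define \<kappa> where "\<kappa> t = (LEAST k. q k = t)" for t
  have \<kappa>: "q (\<kappa> t) = t" if t: "t \<in> range q" for t
  proof -
    from t obtain k where "q k = t" by blast
    then show ?thesis unfolding \<kappa>_def by (rule LeastI)
  qed
  have \<kappa>_le: "\<kappa> (q k) \<le> k" for k unfolding \<kappa>_def by (rule Least_le) simp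
  have qG: "q k \<in> carrier G" for k using q(1) H_carrier by blast
  define r where "r t = (if t \<in> range q then (1/2) ^ \<kappa> t / \<omega> t else 0)" for t
  have r0: "0 \<le> r t" for t using w_pos[OF qG] by (auto simp: r_def less_imp_le)
  have "(\<lambda>n. (1/2 :: real) ^ n) summable_on UNIV"
    by (rule norm_summable_imp_summable_on) (simp add: summable_geometric)
  then have "(\<lambda>n. (1/2 :: real) ^ n) summable_on \<kappa> ` range q"
    by (rule summable_on_subset) simp
  moreover have "inj_on \<kappa> (range q)" by (rule inj_on_inverseI[where g = q]) (rule \<kappa>)
  ultimately have "((\<lambda>n. (1/2 :: real) ^ n) \<circ> \<kappa>) summable_on range q"
    by (simp add: summable_on_reindex)
  then have "(\<lambda>t. cmod (complex_of_real (r t)) * \<omega> t) summable_on carrier G"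
  proof (rule summable_on_cong_neutral[THEN iffD1, rotated -1])
    fix t assume "t \<in> range q \<inter> carrier G"
    then show "((\<lambda>n. (1/2 :: real) ^ n) \<circ> \<kappa>) t = cmod (complex_of_real (r t)) * \<omega> t"
      unfolding norm_of_real abs_of_nonneg[OF r0] using w_pos[of t] by (auto simp: r_def)
  qed (use qG in \<open>auto simp: r_def\<close>)
  moreover have "(1/2) ^ k / \<omega> (q k) \<le> r (q k)" for k
    using w_pos[OF qG[of k]] power_decreasing[OF \<kappa>_le[of k], of "1/2 :: real"]
    by (auto simp: r_def intro!: divide_right_mono)
  moreover have "r t = 0" if "t \<notin> H - {\<one>}" for t using that q by (auto simp: r_def)
  ultimately show ?thesis using r0 H_carrier
    by (intro exI[of _ "\<lambda>t. complex_of_real (r t)"]) (auto simp: B_mem)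
qed

text \<open>Correcting the superposition \<open>p\<close> of the peaks by a multiple of the unit puts it into \<open>L\<close>, and does not
change its pairing with the \<open>\<phi> k\<close>, which vanish at the unit.  All terms of this pairing are nonnegative, so
the single term at \<open>q k\<close> bounds it from below by a multiple of \<open>2\<^sup>-\<^sup>k\<close>.\<close>
lemma L_not_fg:
  assumes sep: "has_peaked_almost_eigenfunctions (G\<lparr>carrier := H\<rparr>) \<omega> \<chi>"
  shows "\<not> has_finite_generating_set L B"
proof
  assume "has_finite_generating_set L B"
  then obtain S where S: "finite S" "S \<subseteq> L" and S_min: "\<forall>J. left_ideal J B \<and> S \<subseteq> J \<longrightarrow> L \<subseteq> J"
    unfolding has_finite_generating_set_def by metis
  interpret C: complex_algebra B by (rule B_complex_algebra)
  have "\<forall>k::nat. \<exists>\<phi> q. q \<in> H \<and> (\<forall>x\<in>H. 0 \<le> \<phi> x \<and> \<phi> x \<le> \<omega> x) \<and> \<phi> \<one> = 0 \<and> \<omega> q \<le> 4 * \<phi> q \<and>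
    (\<forall>f\<in>S. \<forall>s\<in>carrier G. cmod (act (ext \<phi>) f s) \<le> (1/4) ^ k * \<omega> s)"
    by (intro allI exists_almost_annihilating[OF sep S]) simp
  then obtain \<phi> q where q: "\<And>k. q k \<in> H" and \<phi>: "\<And>k. \<forall>x\<in>H. 0 \<le> \<phi> k x \<and> \<phi> k x \<le> \<omega> x"
    and \<phi>1: "\<And>k. \<phi> k \<one> = 0" and \<phi>q: "\<And>k. \<omega> (q k) \<le> 4 * \<phi> k (q k)"
    and \<phi>S: "\<And>k f s. f \<in> S \<Longrightarrow> s \<in> carrier G \<Longrightarrow> cmod (act (ext (\<phi> k)) f s) \<le> (1/4) ^ k * \<omega> s"
    by metis
  have q1: "q k \<noteq> \<one>" for k using \<phi>q[of k] \<phi>1[of k] w_one by auto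
  have bd: "\<forall>x\<in>carrier G. cmod (ext (\<phi> k) x) \<le> 1 * \<omega> x" for k by (rule ext_bound[OF \<phi>])
  have wb: "wbounded (ext (\<phi> k))" for k unfolding wbounded_def using bd by blast
  \<comment> \<open>The rate \<open>4\<^sup>-\<^sup>k\<close> beats the coefficients \<open>2\<^sup>-\<^sup>k\<close> of \<open>p\<close>.\<close>
  define J where "J = {f \<in> carrier B. \<exists>c. \<forall>k. \<forall>s\<in>carrier G. cmod (act (ext (\<phi> k)) f s) \<le> c * (1/4) ^ k * \<omega> s}"
  have J: "left_ideal J B"
  proof (rule C.left_idealI)
    show "\<zero>\<^bsub>B\<^esub> \<in> J" unfolding J_def
      by (auto simp: zero_closed act_def intro!: exI[of _ 0]) (simp add: B_simps)
  next
    fix f g assume "f \<in> J" "g \<in> J"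
    then obtain c c' where f: "f \<in> carrier B" "\<And>k s. s \<in> carrier G \<Longrightarrow> cmod (act (ext (\<phi> k)) f s) \<le> c * (1/4) ^ k * \<omega> s"
      and g: "g \<in> carrier B" "\<And>k s. s \<in> carrier G \<Longrightarrow> cmod (act (ext (\<phi> k)) g s) \<le> c' * (1/4) ^ k * \<omega> s"
      unfolding J_def by blast
    have "cmod (act (ext (\<phi> k)) (f \<oplus>\<^bsub>B\<^esub> g) s) \<le> (c + c') * (1/4) ^ k * \<omega> s" if s: "s \<in> carrier G" for k s
    proof -
      have "cmod (act (ext (\<phi> k)) (f \<oplus>\<^bsub>B\<^esub> g) s) \<le> cmod (act (ext (\<phi> k)) f s) + cmod (act (ext (\<phi> k)) g s)"
        unfolding act_add[OF wb f(1) g(1) s] by (rule norm_triangle_ineq)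
      also have "\<dots> \<le> c * (1/4) ^ k * \<omega> s + c' * (1/4) ^ k * \<omega> s" by (intro add_mono f g s)
      finally show ?thesis by (simp only: distrib_right)
    qed
    then show "f \<oplus>\<^bsub>B\<^esub> g \<in> J" unfolding J_def using add_closed[OF f(1) g(1)] by blast
  next
    fix x f assume x: "x \<in> carrier B" and "f \<in> J"
    then obtain c where f: "f \<in> carrier B" "\<And>k s. s \<in> carrier G \<Longrightarrow> cmod (act (ext (\<phi> k)) f s) \<le> c * (1/4) ^ k * \<omega> s"
      unfolding J_def by blast
    have c0: "0 \<le> c * (1/4) ^ k" for k
      using order_trans[OF norm_ge_zero f(2)[OF one_closed, of k]] w_one by simp
    have "cmod (act (ext (\<phi> k)) (x \<otimes>\<^bsub>B\<^esub> f) s) \<le> (c * wnorm x) * (1/4) ^ k * \<omega> s" if s: "s \<in> carrier G" for k s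
    proof -
      let ?c = "c * (1/4) ^ k"
      have "cmod (act (ext (\<phi> k)) (x \<otimes>\<^bsub>B\<^esub> f) s) \<le> (\<Sum>\<^sub>\<infinity>u\<in>carrier G. ?c * \<omega> s * (cmod (x u) * \<omega> u))"
        unfolding act_mult[OF x f(1) wb s]
      proof (rule dominated_infsum(3))
        show "(\<lambda>u. ?c * \<omega> s * (cmod (x u) * \<omega> u)) summable_on carrier G"
          by (rule summable_on_cmult_right[OF B_summable[OF x]])
        fix u assume u: "u \<in> carrier G"
        have "cmod (act (ext (\<phi> k)) f (s \<otimes> u)) \<le> ?c * \<omega> (s \<otimes> u)" using s u by (intro f) auto
        also have "\<dots> \<le> ?c * (\<omega> s * \<omega> u)" using s u by (intro mult_left_mono w_mult c0)
        finally have "cmod (x u) * cmod (act (ext (\<phi> k)) f (s \<otimes> u)) \<le> cmod (x u) * (?c * (\<omega> s * \<omega> u))"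
          by (rule mult_left_mono) simp
        then show "cmod (x u * act (ext (\<phi> k)) f (s \<otimes> u)) \<le> ?c * \<omega> s * (cmod (x u) * \<omega> u)"
          by (simp only: norm_mult mult_ac)
      qed
      also have "\<dots> = ?c * \<omega> s * wnorm x" unfolding wnorm_def by (rule infsum_cmult_right')
      finally show ?thesis by (simp only: mult_ac)
    qed
    then show "x \<otimes>\<^bsub>B\<^esub> f \<in> J" unfolding J_def using mult_closed[OF x f(1)] by blast
  qed (auto simp: J_def)
  have "S \<subseteq> J"
  proof
    fix f assume f: "f \<in> S"
    then have "f \<in> carrier B" using S(2) by (auto simp: L_def)
    then show "f \<in> J" unfolding J_def using \<phi>S[OF f] by (auto intro!: exI[of _ 1])
  qed
  then have LJ: "L \<subseteq> J" using S_min J by blast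
  obtain p where p: "p \<in> carrier B" and p0: "\<And>t. t \<notin> H - {\<one>} \<Longrightarrow> p t = 0"
    and p_real: "\<And>t. \<exists>r\<ge>0. p t = complex_of_real r"
    and p_peak: "\<And>k. (1/2) ^ k / \<omega> (q k) \<le> Re (p (q k))"
    using exists_summable_peaks[of q] q q1 by metis
  define b where "b = act \<Phi> p \<one>"
  define g where "g = p \<oplus>\<^bsub>B\<^esub> (- b) \<odot>\<^bsub>B\<^esub> \<one>\<^bsub>B\<^esub>"
  have gB: "g \<in> carrier B" unfolding g_def by (intro add_closed smult_closed p one_in_B)
  have act_g: "act \<psi> g s = act \<psi> p s - b * \<psi> s" if "wbounded \<psi>" "s \<in> carrier G" for \<psi> s
    unfolding g_def using that
    by (simp add: act_add p smult_closed one_in_B act_smult act_one)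
  have "act \<Phi> g s = 0" if s: "s \<in> carrier G" for s
  proof (cases "s \<in> H")
    case True
    have "act \<Phi> p s = \<chi> s * b" using act_Phi_shift[OF True one_closed, of p] s by (simp add: b_def)
    then show ?thesis using act_g[OF Phi_wbounded s] True by (simp add: \<Phi>_def)
  next
    case False
    have "\<Phi> (s \<otimes> r) * p r = 0" if r: "r \<in> carrier G" for r
    proof (cases "r \<in> H")
      case True
      have "s \<otimes> r \<notin> H"
      proof
        assume "s \<otimes> r \<in> H"
        then have "s \<otimes> r \<otimes> inv r \<in> H" using True H by (simp add: subgroup.m_closed subgroup.m_inv_closed)
        with False s r show False by (simp add: m_assoc)
      qed
      then show ?thesis by (simp add: \<Phi>_def)
    qed (simp add: p0)
    then have "act \<Phi> p s = 0" unfolding act_def by (intro infsum_0)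
    then show ?thesis using act_g[OF Phi_wbounded s] False by (simp add: \<Phi>_def)
  qed
  then have "g \<in> L" using gB by (simp add: L_def)
  with LJ obtain c where c: "\<And>k s. s \<in> carrier G \<Longrightarrow> cmod (act (ext (\<phi> k)) g s) \<le> c * (1/4) ^ k * \<omega> s"
    unfolding J_def by blast
  have lower: "(1/2) ^ k / 4 \<le> cmod (act (ext (\<phi> k)) g \<one>)" for k
  proof -
    define v where "v t = Re (ext (\<phi> k) t * p t)" for t
    have v0: "0 \<le> v t" for t
    proof -
      obtain r where "r \<ge> 0" "p t = complex_of_real r" using p_real by blast
      then show ?thesis using \<phi>[of k] by (auto simp: v_def ext_def)
    qed
    have s: "(\<lambda>t. ext (\<phi> k) (\<one> \<otimes> t) * p t) summable_on carrier G" by (rule act_summable[OF wb p one_closed])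
    then have s': "(\<lambda>t. ext (\<phi> k) t * p t) summable_on carrier G"
      by (rule summable_on_cong[THEN iffD1, rotated]) simp
    have act_eq: "act (ext (\<phi> k)) p \<one> = (\<Sum>\<^sub>\<infinity>t\<in>carrier G. ext (\<phi> k) t * p t)"
      unfolding act_def by (intro infsum_cong) simp
    have v: "(v has_sum Re (act (ext (\<phi> k)) p \<one>)) (carrier G)"
      unfolding v_def act_eq using has_sum_bounded_linear[OF bounded_linear_Re has_sum_infsum[OF s']] .
    have qG: "q k \<in> carrier G" using q H_carrier by blast
    have wq: "\<omega> (q k) > 0" by (rule w_pos[OF qG])
    have "(1/2) ^ k / 4 = (\<omega> (q k) / 4) * ((1/2) ^ k / \<omega> (q k))" using wq by simp
    also have "\<dots> \<le> \<phi> k (q k) * Re (p (q k))"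
      using \<phi>q[of k] p_peak[of k] wq \<phi>[of k] q[of k] by (intro mult_mono) auto
    also have "\<dots> = v (q k)" using q[of k] by (simp add: v_def ext_def)
    also have "\<dots> \<le> Re (act (ext (\<phi> k)) p \<one>)"
      using finite_sum_le_has_sum[OF v, of "{q k}"] qG v0 by simp
    also have "\<dots> \<le> cmod (act (ext (\<phi> k)) p \<one>)" by (rule complex_Re_le_cmod)
    also have "act (ext (\<phi> k)) p \<one> = act (ext (\<phi> k)) g \<one>"
      using act_g[OF wb one_closed, of k] \<phi>1[of k] by (simp add: ext_def)
    finally show ?thesis .
  qed
  have "2 ^ k \<le> 4 * c" for k :: nat
  proof -
    have "(1/2) ^ k / 4 \<le> c * (1/4) ^ k" using lower[of k] c[OF one_closed, of k] w_one by simp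
    then have "(1/2) ^ k / 4 * (4 * 4 ^ k) \<le> c * (1/4) ^ k * (4 * 4 ^ k)" by (rule mult_right_mono) simp
    moreover have "(1/2 :: real) ^ k / 4 * (4 * 4 ^ k) = 2 ^ k"
      using power_mult_distrib[of "1/2 :: real" 4 k] by simp
    moreover have "c * (1/4) ^ k * (4 * 4 ^ k) = 4 * c" by (simp add: power_divide)
    ultimately show ?thesis by simp
  qed
  moreover obtain k :: nat where "4 * c < 2 ^ k" using real_arch_pow[of 2 "4 * c"] by auto
  ultimately show False by (meson not_le)
qed

end

theorem proposition3p3:
  fixes G :: "('a, 'm) monoid_scheme" and H :: "'a set" and \<omega> :: "'a \<Rightarrow> real"
  assumes "group G"
    and "infinite (carrier G)"
    and "H \<lhd> G"
    and "finite (rcosets\<^bsub>G\<^esub> H)"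
    and "has_infinite_abelian_quotient (G\<lparr>carrier := H\<rparr>)"
    and "weight_on G \<omega>"
  shows "(\<exists>M. maximal_left_ideal M (beurling_algebra G \<omega>) \<and>
              finite_codimension M (beurling_algebra G \<omega>) \<and>
              \<not> finitely_generated_left_ideal M (beurling_algebra G \<omega>)) \<and>
         (\<exists>M. maximal_left_ideal M (beurling_algebra G \<omega>) \<and>
              \<not> finitely_generated_left_ideal M (beurling_algebra G \<omega>))"
proof -
  let ?K = "G\<lparr>carrier := H\<rparr>"
  interpret G: group G by fact
  have H: "subgroup H G" using \<open>H \<lhd> G\<close> by (rule normal_imp_subgroup)
  interpret K: group ?K by (rule subgroup.subgroup_is_group[OF H \<open>group G\<close>])
  have wK: "weight_on ?K \<omega>"
    using \<open>weight_on G \<omega>\<close> subgroup.subset[OF H] by (auto simp: weight_on_def)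
  obtain \<chi> :: "'a \<Rightarrow> real" where \<chi>: "\<forall>x\<in>H. 0 < \<chi> x \<and> \<chi> x \<le> \<omega> x"
      "\<forall>x\<in>H. \<forall>y\<in>H. \<chi> (x \<otimes>\<^bsub>G\<^esub> y) = \<chi> x * \<chi> y"
    and sep: "has_peaked_almost_eigenfunctions ?K \<omega> \<chi>"
    using K.exists_peaked_character[OF wK \<open>has_infinite_abelian_quotient ?K\<close>] by auto
  interpret finite_index_character G \<omega> H \<chi>
    by (intro finite_index_character.intro weighted_group.intro weighted_group_axioms.intro
        finite_index_character_axioms.intro) (use assms H \<chi> in auto)
  interpret C: complex_algebra B by (rule B_complex_algebra)
  obtain n where "C.codim_le L n" using L_codim by blast
  then obtain M m where M: "maximal_left_ideal M B" "C.codim_le M m" "\<not> has_finite_generating_set M B"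
    using C.exists_maximal_without_finite_generating_set[OF L_left_ideal _ L_not_fg[OF sep]] by blast
  have "left_ideal M B" using M(1) by (simp add: maximal_left_ideal_def)
  then have "finite_codimension M B" using M(2) by (rule C.codim_le_imp_finite_codimension)
  moreover have "\<not> finitely_generated_left_ideal M B" using C.finitely_generated_imp_finite_generating_set M(3) by blast
  ultimately show ?thesis using M(1) by blast
qed

end
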